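(* Let $n\in\mathbb{N}$ and let $\hat A$ be a quasi-state. The following are equivalent: (i) $\hat A\in\mathrm{Extr}(\mathcal{A}^n_{\oplus})$; (ii) $W_{\hat A}(\alpha)=P(|\alpha|^2)\,e^{-2|\alpha|^2}$ for all $\alpha\in\mathbb{C}$, where $P(t)=c\,t^{k}\prod_{i=1}^{\ell}(t-\lambda_i)^2$ with $k,\ell\in\mathbb{N}$, $k+2\ell\le n$, $\lambda_i>0$ for all $i$, and $c>0$ a normalization constant; (iii) there exist $m\le n$, a constant $c'>0$ and a vector $\boldsymbol{\mu}\in\mathbb{R}_{\ge0}^m$ whose strictly positive components come in equal pairs, i.e. $\boldsymbol{\mu}=(0,\dots,0,\lambda_1,\lambda_1,\dots,\lambda_\ell,\lambda_\ell)$ (with $k$ zeros, $k+2\ell=m$, $\lambda_i>0$), such that $$\hat A=c'\,(-1)^m\sum_{j=0}^{m}(-1)^j\, j!\, e_{m-j}(\boldsymbol{\mu})\,\hat\sigma(j,0),$$ where $e_j(\boldsymbol{\mu})=\sum_{1\le k_1<\dots<k_j\le m}\mu_{k_1}\cdots\mu_{k_j}$ is the $j$-th elementary symmetric polynomial ($e_0=1$).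
   Context: Let $\mathcal H=L^2(\mathbb R)$ (one bosonic mode) with annihilation operator $\hat a$, number operator $\hat n=\hat a^\dagger\hat a$, Fock basis $\{|k\rangle\}_{k\in\mathbb N}$, displacement operators $\hat D(\alpha)=\exp(\alpha\hat a^\dagger-\alpha^*\hat a)$ and displaced parity operators $\hat\Pi(\alpha)=\hat D(\alpha)(-1)^{\hat n}\hat D(\alpha)^\dagger$. The Wigner function of a trace-class operator $\hat A$ is $W_{\hat A}(\alpha)=\frac{2}{\pi}\mathrm{Tr}[\hat A\,\hat\Pi(\alpha)]$, $\alpha\in\mathbb C$. A quasi-state is a Hermitian trace-class operator of unit trace. $\mathcal A^n$ denotes the set of quasi-states $\hat A$ with $\hat P_n\hat A\hat P_n=\hat A$, where $\hat P_n=\sum_{k=0}^n|k\rangle\langle k|$. $\mathcal A^n_{\oplus}$ is the set of $\hat A\in\mathcal A^n$ that are phase-invariant (i.e. diagonal in the Fock basis) and have $W_{\hat A}(\alpha)\ge0$ for all $\alpha$. For a convex set $\mathcal C$, $\mathrm{Extr}(\mathcal C)$ is the set of $a\in\mathcal C$ such that $a=\frac12(x+y)$ with $x,y\in\mathcal C$ implies $x=y=a$. The binomial state is $\hat\sigma(j,0)=2^{-j}\sum_{k=0}^{j}\binom{j}{k}|k\rangle\langle k|$ (the single-mode output of a balanced beam-splitter fed with $|j\rangle\otimes|0\rangle$, with the second mode traced out). *)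

theory Defs
  imports "HOL-Analysis.Analysis"
begin

text \<open>The single-mode Hilbert space L^2(R) is represented through the Fock basis
  {|k>}, k in nat, i.e. as l^2(nat).  Operators are represented by their
  Fock-basis matrix elements  A k l = <k|A|l>.\<close>

type_synonym fmat = "nat \<Rightarrow> nat \<Rightarrow> complex"

definition hilbert_schmidt :: "fmat \<Rightarrow> bool" where
  "hilbert_schmidt B \<longleftrightarrow> (\<lambda>(k,l). (cmod (B k l))^2) summable_on (UNIV :: (nat \<times> nat) set)"

definition trace_class :: "fmat \<Rightarrow> bool" where
  "trace_class A \<longleftrightarrow> (\<exists>B C. hilbert_schmidt B \<and> hilbert_schmidt C \<and>
      (\<forall>k l. A k l = (\<Sum>\<^sub>\<infinity>j. cnj (B j k) * C j l)))"

definition hermitian_op :: "fmat \<Rightarrow> bool" where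
  "hermitian_op A \<longleftrightarrow> (\<forall>k l. A k l = cnj (A l k))"

definition op_trace :: "fmat \<Rightarrow> complex" where
  "op_trace A = (\<Sum>\<^sub>\<infinity>k. A k k)"

definition quasi_state :: "fmat \<Rightarrow> bool" where
  "quasi_state A \<longleftrightarrow> hermitian_op A \<and> trace_class A \<and> op_trace A = 1"

text \<open>Matrix elements <m|D(alpha)|n> of the displacement operator
  D(alpha) = exp(alpha a^dagger - cnj alpha a) = exp(-|alpha|^2/2) exp(alpha a^dagger) exp(-cnj alpha a).\<close>
definition disp :: "complex \<Rightarrow> fmat" where
  "disp \<alpha> m n = exp (- complex_of_real ((cmod \<alpha>)^2 / 2)) *
     (\<Sum>p\<le>min m n. complex_of_real (sqrt (fact m * fact n) / (fact p * fact (m - p) * fact (n - p)))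
        * \<alpha> ^ (m - p) * (- cnj \<alpha>) ^ (n - p))"

definition disp_parity :: "complex \<Rightarrow> fmat" where
  "disp_parity \<alpha> j k = (\<Sum>\<^sub>\<infinity>p. disp \<alpha> j p * (-1) ^ p * cnj (disp \<alpha> k p))"

definition wigner :: "fmat \<Rightarrow> complex \<Rightarrow> complex" where
  "wigner A \<alpha> = complex_of_real (2 / pi) * (\<Sum>\<^sub>\<infinity>k. \<Sum>\<^sub>\<infinity>j. A k j * disp_parity \<alpha> j k)"

text \<open>P_n A P_n = A.\<close>
definition supported_upto :: "nat \<Rightarrow> fmat \<Rightarrow> bool" where
  "supported_upto n A \<longleftrightarrow> (\<forall>k l. n < k \<or> n < l \<longrightarrow> A k l = 0)"

definition quasi_states_upto :: "nat \<Rightarrow> fmat set" where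
  "quasi_states_upto n = {A. quasi_state A \<and> supported_upto n A}"

definition phase_invariant :: "fmat \<Rightarrow> bool" where
  "phase_invariant A \<longleftrightarrow> (\<forall>k l. k \<noteq> l \<longrightarrow> A k l = 0)"

definition wigner_nonneg :: "fmat \<Rightarrow> bool" where
  "wigner_nonneg A \<longleftrightarrow> (\<forall>\<alpha>. Im (wigner A \<alpha>) = 0 \<and> 0 \<le> Re (wigner A \<alpha>))"

definition A_oplus :: "nat \<Rightarrow> fmat set" where
  "A_oplus n = {A \<in> quasi_states_upto n. phase_invariant A \<and> wigner_nonneg A}"

definition extreme_points :: "fmat set \<Rightarrow> fmat set" where
  "extreme_points S = {a \<in> S. \<forall>x y. x \<in> S \<and> y \<in> S \<and>
       (\<forall>k l. a k l = (x k l + y k l) / 2) \<longrightarrow> x = a \<and> y = a}"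

definition binom_state :: "nat \<Rightarrow> fmat" where
  "binom_state j k l = (if k = l \<and> k \<le> j then complex_of_real ((1/2)^j * real (j choose k)) else 0)"

definition esym :: "nat \<Rightarrow> (nat \<Rightarrow> real) \<Rightarrow> nat \<Rightarrow> real" where
  "esym m \<mu> j = (\<Sum>S\<in>{S. S \<subseteq> {..<m} \<and> card S = j}. \<Prod>i\<in>S. \<mu> i)"

end

theory Submission
  imports Defs "HOL-Complex_Analysis.Cauchy_Integral_Formula" "HOL-Library.Real_Mod"
begin

text \<open>With \<open>t = \<bar>\<alpha>\<bar>\<^sup>2\<close>, the Wigner function of \<open>\<sigma>(j,0)\<close> is a multiple of \<open>t\<^sup>j exp (- 2 t)\<close>.
  Hence the phase-invariant quasi-states on the first \<open>n + 1\<close> Fock states correspond linearly to the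
  normalised polynomials of degree at most \<open>n\<close>, and Wigner positivity to nonnegativity on \<open>t \<ge> 0\<close>.
  A nonnegative \<open>P\<close> factors as \<open>t\<^sup>k \<Prod>(t - \<lambda>\<^sub>i)\<^sup>2 R\<close> with \<open>R > 0\<close> on \<open>t \<ge> 0\<close>. If \<open>R\<close> is not constant, then it
  exceeds some \<open>\<delta> > 0\<close>, and splitting \<open>R = \<delta> + (R - \<delta>)\<close> shows that \<open>P\<close> is not extreme. If \<open>R\<close> is
  constant, every nonnegative polynomial dominated by \<open>P\<close> has the same roots, hence is a multiple of \<open>P\<close>.
  The formula in (iii) is the expansion of \<open>P\<close> in elementary symmetric polynomials of its roots.

  In (ii) nothing is assumed about the Fock support of \<open>A\<close>, so the Wigner function must determine
  a general trace-class operator. By \<open>D(\<alpha>) (-1)\<^sup>n D(\<alpha>)\<^sup>\<dagger> = D(2 \<alpha>) (-1)\<^sup>n\<close> its values are traces against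
  operators with orthonormal rows, so they are uniform limits of those of finite truncations.
  Averaging over phases isolates each off-diagonal, and integrating against \<open>x\<^sup>d exp (- s x)\<close> turns its Laguerre
  expansion into a power series that vanishes identically.\<close>

section \<open>Displacement operators and displaced parity in the Fock basis\<close>

lemma has_sum_finite_sum:
  fixes f :: "'i \<Rightarrow> 'a \<Rightarrow> 'b::topological_comm_monoid_add"
  assumes "finite I" "\<And>i. i \<in> I \<Longrightarrow> (f i has_sum s i) A"
  shows "((\<lambda>x. \<Sum>i\<in>I. f i x) has_sum (\<Sum>i\<in>I. s i)) A"
  using assms by (induction I rule: finite_induct) (auto intro!: has_sum_add)

lemma has_sum_exp_complex:
  fixes z :: complex
  shows "((\<lambda>q. z ^ q / fact q) has_sum exp z) UNIV"
proof -
  have "summable (\<lambda>q. norm (z ^ q / fact q))"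
    using summable_norm_exp[of z] by (simp add: divide_inverse scaleR_conv_of_real mult.commute)
  moreover have "(\<lambda>q. z ^ q / fact q) sums exp z"
    using exp_converges[of z] by (simp add: divide_inverse scaleR_conv_of_real mult.commute)
  ultimately show ?thesis by (rule norm_summable_imp_has_sum)
qed

text \<open>Vandermonde's identity for \<open>p choose a\<close>, with \<open>p\<close> split as
  \<open>b + (p - b)\<close>, multiplied by \<open>fact a / fact (p - b)\<close>. Where
  \<open>a + b - c\<close> exceeds \<open>p\<close> the binomial coefficient is 0, but truncated
  subtraction would yield \<open>fact 0\<close>; hence the \<open>if\<close>.\<close>

lemma fact_quotient_vandermonde:
  fixes a b p :: nat
  assumes "a \<le> p" "b \<le> p"
  shows "(fact p :: 'a::field_char_0) / (fact (p - a) * fact (p - b)) =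
    (\<Sum>c\<le>min a b. if a + b - c \<le> p
       then fact a * fact b / (fact c * fact (a - c) * fact (b - c)) / fact (p - (a + b - c)) else 0)"
proof -
  have "(\<Sum>c\<le>min a b. if a + b - c \<le> p
       then fact a * fact b / (fact c * fact (a - c) * fact (b - c)) / fact (p - (a + b - c)) else 0)
     = (\<Sum>c\<le>a. fact a / fact (p - b) * of_nat ((b choose c) * ((p - b) choose (a - c))) :: 'a)"
  proof (rule sum.mono_neutral_cong_left)
    show "\<forall>i\<in>{..a} - {..min a b}. fact a / fact (p - b) * of_nat ((b choose i) * (p - b choose (a - i))) = (0::'a)"
      by auto
    fix c assume c: "c \<in> {..min a b}"
    show "(if a + b - c \<le> p
       then fact a * fact b / (fact c * fact (a - c) * fact (b - c)) / fact (p - (a + b - c)) else 0)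
       = fact a / fact (p - b) * (of_nat ((b choose c) * ((p - b) choose (a - c))) :: 'a)"
    proof (cases "a + b - c \<le> p")
      case True
      have 1: "of_nat (b choose c) = (fact b / (fact c * fact (b - c)) :: 'a)"
        using c by (intro binomial_fact) auto
      have "of_nat ((p-b) choose (a-c)) = (fact (p-b) / (fact (a-c) * fact (p - b - (a-c))) :: 'a)"
        using c True by (intro binomial_fact) auto
      moreover have "p - b - (a-c) = p - (a + b - c)" using c True by auto
      ultimately have 2: "of_nat ((p-b) choose (a-c)) = (fact (p-b) / (fact (a-c) * fact (p - (a+b-c))) :: 'a)"
        by simp
      show ?thesis using True by (simp add: 1 2)
    next
      case False
      then have "(p - b) choose (a - c) = 0" using c assms by (intro binomial_eq_0) auto
      then show ?thesis using False by simp
    qed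
  qed auto
  also have "\<dots> = fact a / fact (p - b) * of_nat ((b + (p - b)) choose a)"
    by (simp only: vandermonde[symmetric] of_nat_sum sum_distrib_left)
  also have "b + (p - b) = p" using assms by simp
  also have "of_nat (p choose a) = (fact p / (fact a * fact (p - a)) :: 'a)"
    using assms by (intro binomial_fact) auto
  finally show ?thesis by simp
qed

text \<open>This is the sum over intermediate Fock states \<open>p\<close> when annihilators on the
  left meet creators on the right. \<open>fact_quotient_vandermonde\<close> splits it over
  \<open>c\<close>; with \<open>q = p - (a + b - c)\<close> the \<open>c\<close>-th part is the
  exponential series in \<open>x * y\<close> times \<open>x ^ (b - c) * y ^ (a - c)\<close>.\<close>

lemma has_sum_shifted_exp:
  fixes a b :: nat and x y :: complex
  shows "((\<lambda>p. if a \<le> p \<and> b \<le> p then fact p / (fact (p - a) * fact (p - b)) * x ^ (p - a) * y ^ (p - b) else 0)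
    has_sum exp (x * y) * (\<Sum>c\<le>min a b. fact a * fact b / (fact c * fact (a - c) * fact (b - c)) * x ^ (b - c) * y ^ (a - c))) UNIV"
proof -
  define k where "k c = (fact a * fact b / (fact c * fact (a - c) * fact (b - c)) :: complex)" for c
  define g where "g c p = (if a + b - c \<le> p then k c / fact (p - (a + b - c)) * x ^ (p - a) * y ^ (p - b) else 0)" for c p
  have "(g c has_sum k c * x ^ (b - c) * y ^ (a - c) * exp (x * y)) UNIV" if c: "c \<le> min a b" for c
  proof -
    have "((\<lambda>q. k c * x ^ (b - c) * y ^ (a - c) * ((x*y) ^ q / fact q)) has_sum (k c * x ^ (b - c) * y ^ (a - c) * exp (x * y))) UNIV"
      by (intro has_sum_cmult_right has_sum_exp_complex)
    also have "?this \<longleftrightarrow> (g c has_sum (k c * x ^ (b - c) * y ^ (a - c) * exp (x * y))) {a + b - c..}"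
    proof (rule has_sum_reindex_bij_witness[of _ "\<lambda>p. p - (a+b-c)" "\<lambda>q. q + (a+b-c)"])
      fix q :: nat
      have "q + (a + b - c) - a = q + (b - c)" "q + (a + b - c) - b = q + (a - c)" using c by auto
      then show "g c (q + (a + b - c)) = k c * x ^ (b - c) * y ^ (a - c) * ((x*y) ^ q / fact q)"
        by (simp add: g_def power_add power_mult_distrib)
    qed auto
    also have "\<dots> \<longleftrightarrow> (g c has_sum (k c * x ^ (b - c) * y ^ (a - c) * exp (x * y))) UNIV"
      by (rule has_sum_cong_neutral) (auto simp: g_def)
    finally show ?thesis .
  qed
  then have "((\<lambda>p. \<Sum>c\<le>min a b. g c p) has_sum (\<Sum>c\<le>min a b. k c * x ^ (b - c) * y ^ (a - c) * exp (x * y))) UNIV"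
    by (intro has_sum_finite_sum) auto
  also have "(\<Sum>c\<le>min a b. k c * x ^ (b - c) * y ^ (a - c) * exp (x * y)) = exp (x * y) * (\<Sum>c\<le>min a b. k c * x ^ (b - c) * y ^ (a - c))"
    by (simp add: sum_distrib_left mult.commute)
  also have "(\<lambda>p. \<Sum>c\<le>min a b. g c p) = (\<lambda>p. if a \<le> p \<and> b \<le> p then fact p / (fact (p - a) * fact (p - b)) * x ^ (p - a) * y ^ (p - b) else 0)"
  proof
    fix p
    show "(\<Sum>c\<le>min a b. g c p) = (if a \<le> p \<and> b \<le> p then fact p / (fact (p - a) * fact (p - b)) * x ^ (p - a) * y ^ (p - b) else 0)"
    proof (cases "a \<le> p \<and> b \<le> p")
      case True
      then have "fact p / (fact (p - a) * fact (p - b)) = (\<Sum>c\<le>min a b. if a + b - c \<le> p then k c / fact (p - (a + b - c)) else 0)"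
        unfolding k_def by (intro fact_quotient_vandermonde) auto
      then show ?thesis using True
        by (auto simp: sum_distrib_right g_def intro!: sum.cong)
    next
      case False
      then show ?thesis by (auto simp: g_def intro!: sum.neutral)
    qed
  qed
  finally show ?thesis by (simp add: k_def)
qed

text \<open>Matrix elements of the normally ordered product \<open>exp (u a\<^sup>\<dagger>) exp (v a)\<close>.\<close>
definition normal_ordered :: "complex \<Rightarrow> complex \<Rightarrow> fmat" where
  "normal_ordered u v m n = (\<Sum>p\<le>min m n. complex_of_real (sqrt (fact m * fact n) / (fact p * fact (m - p) * fact (n - p)))
        * u ^ (m - p) * v ^ (n - p))"

lemma disp_normal_ordered:
  "disp \<alpha> m n = exp (- complex_of_real ((cmod \<alpha>)^2 / 2)) * normal_ordered \<alpha> (- cnj \<alpha>) m n"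
  by (simp add: disp_def normal_ordered_def)

lemma normal_ordered_swap: "normal_ordered u v m n = normal_ordered v u n m"
  by (simp add: normal_ordered_def min.commute mult_ac)

lemma cnj_normal_ordered: "cnj (normal_ordered u v m n) = normal_ordered (cnj u) (cnj v) m n"
  by (simp add: normal_ordered_def)

text \<open>Conjugation by the parity operator sends the annihilation and creation operators to
  their negatives, which produces the sign.\<close>

lemma normal_ordered_uminus: "normal_ordered (- u) (- v) m n = (-1) ^ (m + n) * normal_ordered u v m n"
proof -
  have "(- u) ^ (m - p) * (- v) ^ (n - p) = (-1) ^ (m + n) * (u ^ (m - p) * v ^ (n - p))" if "p \<le> min m n" for p
  proof -
    have "(m + n) = (m - p) + (n - p) + 2 * p" using that by auto
    then have "(-1::complex) ^ (m + n) = (-1) ^ (m - p) * (-1) ^ (n - p)"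
      by (simp only: power_add power_mult) simp
    then show ?thesis by (simp add: power_minus[of u] power_minus[of v] mult_ac)
  qed
  then show ?thesis unfolding normal_ordered_def sum_distrib_left
    by (intro sum.cong refl) (simp only: atMost_iff mult.assoc mult.left_commute[of _ "(-1) ^ (m + n)"])
qed

lemma normal_ordered_0: "normal_ordered 0 0 m n = (if m = n then 1 else 0)"
proof (cases "m = n")
  case True
  have "normal_ordered 0 0 n n = (\<Sum>p\<le>n. if p = n then 1 else 0)"
    unfolding normal_ordered_def by (intro sum.cong) auto
  then show ?thesis using True by simp
next
  case False
  then show ?thesis unfolding normal_ordered_def by (auto simp: power_0_left intro!: sum.neutral)
qed

text \<open>The binomial theorem with divided powers. The lower bound \<open>c\<close> is an
  \<open>if\<close> inside the sum, so that the range stays independent of \<open>c\<close> when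
  sums are exchanged in \<open>normal_ordered_mult\<close>.\<close>

lemma binomial_fact_sum:
  fixes x y :: "'a::field_char_0"
  assumes "c \<le> j"
  shows "(\<Sum>a\<le>j. if c \<le> a then x ^ (j - a) * y ^ (a - c) / (fact (j - a) * fact (a - c)) else 0) = (x + y) ^ (j - c) / fact (j - c)"
proof -
  have "(\<Sum>a\<le>j. if c \<le> a then x ^ (j - a) * y ^ (a - c) / (fact (j - a) * fact (a - c)) else 0)
      = (\<Sum>a=c..j. x ^ (j - a) * y ^ (a - c) / (fact (j - a) * fact (a - c)))"
    by (rule sum.mono_neutral_cong_right) auto
  also have "\<dots> = (\<Sum>i\<le>j - c. x ^ (j - c - i) * y ^ i / (fact (j - c - i) * fact i))"
    by (rule sum.reindex_bij_witness[of _ "\<lambda>i. i + c" "\<lambda>a. a - c"]) (use assms in \<open>auto simp: add.commute\<close>)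
  also have "\<dots> = (y + x) ^ (j - c) / fact (j - c)"
    unfolding binomial_ring sum_divide_distrib
    by (intro sum.cong refl) (simp add: binomial_fact field_simps)
  finally show ?thesis by (simp add: add.commute)
qed

text \<open>Moving the inner annihilation exponential past the inner creation exponential costs the
  scalar \<open>exp (v * u')\<close>; then exponents of the same kind add. In coordinates,
  \<open>has_sum_shifted_exp\<close> performs the sum over \<open>p\<close> and
  \<open>binomial_fact_sum\<close> recombines the powers.\<close>

lemma normal_ordered_mult:
  "((\<lambda>p. normal_ordered u v j p * normal_ordered u' v' p k) has_sum
     exp (v * u') * normal_ordered (u + u') (v + v') j k) UNIV"
proof -
  define s where "s = (\<lambda>m. complex_of_real (sqrt (fact m)))"
  define A where "A a = s j / (fact a * fact (j - a)) * u ^ (j - a)" for a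
  define B where "B b = s k / (fact b * fact (k - b)) * v' ^ (k - b)" for b
  define F where "F a b p = (if a \<le> p \<and> b \<le> p then fact p / (fact (p - a) * fact (p - b)) * v ^ (p - a) * u' ^ (p - b) else 0)" for a b p
  define G where "G a b = exp (v * u') * (\<Sum>c\<le>min a b. fact a * fact b / (fact c * fact (a - c) * fact (b - c)) * v ^ (b - c) * u' ^ (a - c))" for a b :: nat
  have ss: "s p * s p = fact p" for p
    by (simp add: s_def of_real_mult[symmetric] del: of_real_mult)
  have "((\<lambda>p. \<Sum>a\<le>j. \<Sum>b\<le>k. A a * B b * F a b p) has_sum (\<Sum>a\<le>j. \<Sum>b\<le>k. A a * B b * G a b)) UNIV"
    unfolding F_def G_def
    by (intro has_sum_finite_sum has_sum_cmult_right has_sum_shifted_exp) auto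
  also have "(\<lambda>p. \<Sum>a\<le>j. \<Sum>b\<le>k. A a * B b * F a b p) = (\<lambda>p. normal_ordered u v j p * normal_ordered u' v' p k)"
  proof
    fix p
    have 1: "normal_ordered u v j p = (\<Sum>a\<le>j. if a \<le> p then A a * (s p * v ^ (p - a) / fact (p - a)) else 0)"
      unfolding normal_ordered_def
      by (intro sum.mono_neutral_cong_left) (auto simp: A_def s_def real_sqrt_mult)
    have 2: "normal_ordered u' v' p k = (\<Sum>b\<le>k. if b \<le> p then B b * (s p * u' ^ (p - b) / fact (p - b)) else 0)"
      unfolding normal_ordered_def
      by (intro sum.mono_neutral_cong_left) (auto simp: B_def s_def real_sqrt_mult mult_ac)
    show "(\<Sum>a\<le>j. \<Sum>b\<le>k. A a * B b * F a b p) = normal_ordered u v j p * normal_ordered u' v' p k"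
      unfolding 1 2 sum_product
      by (intro sum.cong refl) (auto simp: F_def ss[of p, symmetric] mult_ac)
  qed
  also have "(\<Sum>a\<le>j. \<Sum>b\<le>k. A a * B b * G a b) = exp (v * u') * normal_ordered (u + u') (v + v') j k"
  proof -
    \<comment> \<open>For a fixed contraction index \<open>c\<close> the double sum over
      \<open>a\<close> and \<open>b\<close> factorises; \<open>U\<close> and \<open>V\<close> are
      the two factors in the form of \<open>binomial_fact_sum\<close>.\<close>
    define U where "U c a = (if c \<le> a then u ^ (j - a) * u' ^ (a - c) / (fact (j - a) * fact (a - c)) else 0)" for c a
    define V where "V c b = (if c \<le> b then v' ^ (k - b) * v ^ (b - c) / (fact (k - b) * fact (b - c)) else 0)" for c b
    have "A a * B b * G a b = exp (v * u') * (\<Sum>c\<le>min j k. s j * s k / fact c * U c a * V c b)"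
      if "a \<le> j" "b \<le> k" for a b
    proof -
      have "(\<Sum>c\<le>min j k. s j * s k / fact c * U c a * V c b)
          = A a * B b * (\<Sum>c\<le>min a b. fact a * fact b / (fact c * fact (a - c) * fact (b - c)) * v ^ (b - c) * u' ^ (a - c))"
        unfolding sum_distrib_left
        by (rule sum.mono_neutral_cong_right) (use that in \<open>auto simp: U_def V_def A_def B_def mult_ac\<close>)
      then show ?thesis by (simp add: G_def)
    qed
    then have "(\<Sum>a\<le>j. \<Sum>b\<le>k. A a * B b * G a b) = (\<Sum>a\<le>j. \<Sum>b\<le>k. exp (v * u') * (\<Sum>c\<le>min j k. s j * s k / fact c * U c a * V c b))"
      by (intro sum.cong refl) auto
    also have "\<dots> = exp (v * u') * (\<Sum>a\<le>j. \<Sum>b\<le>k. \<Sum>c\<le>min j k. s j * s k / fact c * U c a * V c b)"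
      by (simp only: sum_distrib_left)
    also have "(\<Sum>a\<le>j. \<Sum>b\<le>k. \<Sum>c\<le>min j k. s j * s k / fact c * U c a * V c b)
       = (\<Sum>a\<le>j. \<Sum>c\<le>min j k. \<Sum>b\<le>k. s j * s k / fact c * U c a * V c b)"
      by (rule sum.cong[OF refl], rule sum.swap)
    also have "\<dots> = (\<Sum>c\<le>min j k. \<Sum>a\<le>j. \<Sum>b\<le>k. s j * s k / fact c * U c a * V c b)"
      by (rule sum.swap)
    also have "\<dots> = (\<Sum>c\<le>min j k. s j * s k / fact c * (\<Sum>a\<le>j. U c a) * (\<Sum>b\<le>k. V c b))"
    proof (intro sum.cong refl)
      fix c
      show "(\<Sum>a\<le>j. \<Sum>b\<le>k. s j * s k / fact c * U c a * V c b) = s j * s k / fact c * (\<Sum>a\<le>j. U c a) * (\<Sum>b\<le>k. V c b)"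
        unfolding mult.assoc sum_product by (simp only: sum_distrib_left mult.assoc)
    qed
    also have "\<dots> = normal_ordered (u + u') (v + v') j k"
      unfolding normal_ordered_def
    proof (intro sum.cong refl)
      fix c assume c: "c \<in> {..min j k}"
      have "(\<Sum>a\<le>j. U c a) = (u + u') ^ (j - c) / fact (j - c)" "(\<Sum>b\<le>k. V c b) = (v' + v) ^ (k - c) / fact (k - c)"
        unfolding U_def V_def using c by (auto intro!: binomial_fact_sum)
      then show "s j * s k / fact c * (\<Sum>a\<le>j. U c a) * (\<Sum>b\<le>k. V c b) =
         complex_of_real (sqrt (fact j * fact k) / (fact c * fact (j - c) * fact (k - c))) * (u + u') ^ (j - c) * (v + v') ^ (k - c)"
        by (simp add: s_def real_sqrt_mult add.commute)
    qed
    finally show ?thesis .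
  qed
  finally show ?thesis .
qed

lemma exp_normalisation:
  "exp (- complex_of_real ((cmod \<alpha>)^2 / 2)) * exp (- complex_of_real ((cmod \<alpha>)^2 / 2)) = exp (- complex_of_real ((cmod \<alpha>)^2))"
  by (simp add: exp_add[symmetric] flip: add_divide_distrib)

text \<open>Moving the parity to the right turns the adjoint of D(\<alpha>) into D(\<alpha>),
  because it reverses the sign of the displacement. This leaves D(\<alpha>)^2 = D(2 \<alpha>) times
  the parity, which multiplies column \<open>k\<close> by its sign.\<close>

lemma disp_parity_eq: "disp_parity \<alpha> j k = (-1) ^ k * disp (2 * \<alpha>) j k"
proof -
  define c where "c = exp (- complex_of_real ((cmod \<alpha>)^2 / 2))"
  have cc: "c * c = exp (- complex_of_real ((cmod \<alpha>)^2))" unfolding c_def by (rule exp_normalisation)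
  have cnjc: "cnj c = c" unfolding c_def by (simp add: exp_cnj)
  have t: "disp \<alpha> j p * (-1) ^ p * cnj (disp \<alpha> k p) = c * c * (-1) ^ k * (normal_ordered \<alpha> (- cnj \<alpha>) j p * normal_ordered \<alpha> (- cnj \<alpha>) p k)" for p
  proof -
    have "cnj (disp \<alpha> k p) = c * normal_ordered (- \<alpha>) (- (- cnj \<alpha>)) p k"
      unfolding disp_normal_ordered c_def[symmetric]
      by (simp add: cnj_normal_ordered cnjc normal_ordered_swap[of _ _ k p])
    also have "\<dots> = c * ((-1) ^ (p + k) * normal_ordered \<alpha> (- cnj \<alpha>) p k)"
      by (simp only: normal_ordered_uminus)
    finally show ?thesis unfolding disp_normal_ordered[of _ j] c_def[symmetric] by (simp add: power_add)
  qed
  have "((\<lambda>p. disp \<alpha> j p * (-1) ^ p * cnj (disp \<alpha> k p)) has_sum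
     (c * c * (-1) ^ k * (exp (- cnj \<alpha> * \<alpha>) * normal_ordered (\<alpha> + \<alpha>) (- cnj \<alpha> + - cnj \<alpha>) j k))) UNIV"
    unfolding t by (intro has_sum_cmult_right normal_ordered_mult)
  then have "disp_parity \<alpha> j k = c * c * (-1) ^ k * (exp (- cnj \<alpha> * \<alpha>) * normal_ordered (\<alpha> + \<alpha>) (- cnj \<alpha> + - cnj \<alpha>) j k)"
    unfolding disp_parity_def by (rule infsumI)
  also have "\<dots> = (-1) ^ k * ((c * c * exp (- cnj \<alpha> * \<alpha>)) * normal_ordered (2 * \<alpha>) (- cnj (2 * \<alpha>)) j k)"
    by (simp only: mult_2[of \<alpha>] complex_cnj_add minus_add_distrib mult.assoc mult.left_commute[of _ "(-1) ^ k"])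
  \<comment> \<open>Half of the exponent comes from the two normalisation constants, the other half
    from reordering the product.\<close>
  also have "c * c * exp (- cnj \<alpha> * \<alpha>) = exp (- complex_of_real ((cmod (2*\<alpha>))^2 / 2))"
    unfolding cc exp_add[symmetric]
    by (simp add: norm_mult power_mult_distrib complex_norm_square[symmetric] mult.commute flip: of_real_power)
  finally show ?thesis by (simp add: disp_normal_ordered)
qed

text \<open>The adjoint of D(\<alpha>) is D(-\<alpha>): in \<open>normal_ordered_mult\<close> the
  arguments add up to 0, and the scalar exp(|\<alpha>|^2) cancels the normalisation.\<close>

lemma disp_rows_orthonormal:
  "((\<lambda>k. disp \<alpha> i k * cnj (disp \<alpha> j k)) has_sum (if i = j then 1 else 0)) UNIV"
proof -
  define c where "c = exp (- complex_of_real ((cmod \<alpha>)^2 / 2))"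
  have cc: "c * c = exp (- complex_of_real ((cmod \<alpha>)^2))" unfolding c_def by (rule exp_normalisation)
  have cnjc: "cnj c = c" unfolding c_def by (simp add: exp_cnj)
  have t: "disp \<alpha> i k * cnj (disp \<alpha> j k) = c * c * (normal_ordered \<alpha> (- cnj \<alpha>) i k * normal_ordered (- \<alpha>) (cnj \<alpha>) k j)" for k
    unfolding disp_normal_ordered c_def[symmetric]
    by (simp add: cnj_normal_ordered cnjc normal_ordered_swap[of _ _ j k])
  have "((\<lambda>k. disp \<alpha> i k * cnj (disp \<alpha> j k)) has_sum
     (c * c * (exp (- cnj \<alpha> * - \<alpha>) * normal_ordered (\<alpha> + - \<alpha>) (- cnj \<alpha> + cnj \<alpha>) i j))) UNIV"
    unfolding t by (intro has_sum_cmult_right normal_ordered_mult)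
  also have "c * c * (exp (- cnj \<alpha> * - \<alpha>) * normal_ordered (\<alpha> + - \<alpha>) (- cnj \<alpha> + cnj \<alpha>) i j) = (if i = j then 1 else 0)"
    unfolding mult.assoc[symmetric] cc exp_add[symmetric]
    using complex_norm_square[of \<alpha>] by (simp add: normal_ordered_0 mult.commute)
  finally show ?thesis .
qed

section \<open>Hilbert-Schmidt estimates and uniform truncation of traces\<close>

lemma cauchy_schwarz_infsum:
  fixes f g :: "'a \<Rightarrow> complex"
  assumes f: "(\<lambda>x. (cmod (f x))\<^sup>2) summable_on A" and g: "(\<lambda>x. (cmod (g x))\<^sup>2) summable_on A"
  shows "(\<lambda>x. cmod (f x * g x)) summable_on A"
    and "(\<lambda>x. f x * g x) summable_on A"
    and "cmod (\<Sum>\<^sub>\<infinity>x\<in>A. f x * g x) \<le> sqrt (\<Sum>\<^sub>\<infinity>x\<in>A. (cmod (f x))\<^sup>2) * sqrt (\<Sum>\<^sub>\<infinity>x\<in>A. (cmod (g x))\<^sup>2)"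
proof -
  show 1: "(\<lambda>x. cmod (f x * g x)) summable_on A"
    by (rule abs_summable_product) (use f g in \<open>simp_all add: norm_mult power2_eq_square\<close>)
  then show "(\<lambda>x. f x * g x) summable_on A" by (rule abs_summable_summable)
  have "(\<Sum>\<^sub>\<infinity>x\<in>A. cmod (f x * g x)) \<le> sqrt (\<Sum>\<^sub>\<infinity>x\<in>A. (cmod (f x))\<^sup>2) * sqrt (\<Sum>\<^sub>\<infinity>x\<in>A. (cmod (g x))\<^sup>2)"
  proof (rule infsum_le_finite_sums[OF 1])
    fix F assume F: "finite F" "F \<subseteq> A"
    have "(\<Sum>x\<in>F. cmod (f x * g x)) \<le> L2_set (\<lambda>x. cmod (f x)) F * L2_set (\<lambda>x. cmod (g x)) F"
      using L2_set_mult_ineq[of "\<lambda>x. cmod (f x)" "\<lambda>x. cmod (g x)" F] by (simp add: norm_mult)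
    also have "\<dots> \<le> sqrt (\<Sum>\<^sub>\<infinity>x\<in>A. (cmod (f x))\<^sup>2) * sqrt (\<Sum>\<^sub>\<infinity>x\<in>A. (cmod (g x))\<^sup>2)"
      unfolding L2_set_def using F f g
      by (intro mult_mono real_sqrt_le_mono finite_sum_le_infsum) (auto intro!: sum_nonneg infsum_nonneg)
    finally show "(\<Sum>x\<in>F. cmod (f x * g x)) \<le> \<dots>" .
  qed
  then show "cmod (\<Sum>\<^sub>\<infinity>x\<in>A. f x * g x) \<le> sqrt (\<Sum>\<^sub>\<infinity>x\<in>A. (cmod (f x))\<^sup>2) * sqrt (\<Sum>\<^sub>\<infinity>x\<in>A. (cmod (g x))\<^sup>2)"
    using norm_infsum_bound[OF 1] by linarith
qed

text \<open>The relation says that \<open>U\<close> times its adjoint is the identity. The estimates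
  below depend on \<open>U\<close> through it alone, which makes them uniform in the
  displacement.\<close>

definition orthonormal_rows :: "fmat \<Rightarrow> bool" where
  "orthonormal_rows U \<longleftrightarrow> (\<forall>i j. ((\<lambda>k. U i k * cnj (U j k)) has_sum (if i = j then 1 else 0)) UNIV)"

lemma orthonormal_rows_finite_combination:
  assumes U: "orthonormal_rows U" and "finite J"
  shows "((\<lambda>k. (cmod (\<Sum>j\<in>J. v j * U j k))\<^sup>2) has_sum (\<Sum>j\<in>J. (cmod (v j))\<^sup>2)) UNIV"
proof -
  have "((\<lambda>k. \<Sum>i\<in>J. \<Sum>j\<in>J. (v i * cnj (v j)) * (U i k * cnj (U j k))) has_sum
      (\<Sum>i\<in>J. \<Sum>j\<in>J. (v i * cnj (v j)) * (if i = j then 1 else 0))) UNIV"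
    using U \<open>finite J\<close> unfolding orthonormal_rows_def
    by (intro has_sum_finite_sum has_sum_cmult_right) auto
  also have "(\<Sum>i\<in>J. \<Sum>j\<in>J. (v i * cnj (v j)) * (if i = j then 1 else 0)) = complex_of_real (\<Sum>j\<in>J. (cmod (v j))\<^sup>2)"
  proof -
    have "(\<Sum>j\<in>J. (v i * cnj (v j)) * (if i = j then 1 else 0)) = v i * cnj (v i)" if "i \<in> J" for i
      using that \<open>finite J\<close> by (simp add: if_distrib cong: if_cong)
    then show ?thesis by (simp add: complex_norm_square del: of_real_power)
  qed
  also have "(\<lambda>k. \<Sum>i\<in>J. \<Sum>j\<in>J. (v i * cnj (v j)) * (U i k * cnj (U j k))) = (\<lambda>k. complex_of_real ((cmod (\<Sum>j\<in>J. v j * U j k))\<^sup>2))"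
    unfolding complex_norm_square cnj_sum sum_product by (simp add: mult_ac)
  finally show ?thesis by (simp only: has_sum_of_real_iff)
qed

text \<open>Let s be the sum of |U j k|^2 over a finite set of rows. The combination of these rows
  with coefficients \<open>cnj (U j k)\<close> has squared norm s, while its entry at
  \<open>k\<close> is s itself; so s^2 \<le> s and s \<le> 1.\<close>

lemma orthonormal_rows_column_summable:
  assumes U: "orthonormal_rows U"
  shows "(\<lambda>j. (cmod (U j k))\<^sup>2) summable_on UNIV"
proof (rule nonneg_bdd_above_summable_on)
  show "bdd_above (sum (\<lambda>j. (cmod (U j k))\<^sup>2) ` {F. F \<subseteq> UNIV \<and> finite F})"
  proof (rule bdd_aboveI2)
    fix J :: "nat set" assume "J \<in> {F. F \<subseteq> UNIV \<and> finite F}"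
    then have J: "finite J" by simp
    let ?s = "\<Sum>j\<in>J. (cmod (U j k))\<^sup>2"
    have h: "((\<lambda>k'. (cmod (\<Sum>j\<in>J. cnj (U j k) * U j k'))\<^sup>2) has_sum ?s) UNIV"
      using orthonormal_rows_finite_combination[OF U J, of "\<lambda>j. cnj (U j k)"] by simp
    have "(\<Sum>j\<in>J. cnj (U j k) * U j k) = complex_of_real ?s"
      by (simp add: complex_norm_square mult.commute del: of_real_power)
    moreover have "0 \<le> ?s" by (simp add: sum_nonneg)
    ultimately have "?s\<^sup>2 = (\<Sum>k'\<in>{k}. (cmod (\<Sum>j\<in>J. cnj (U j k) * U j k'))\<^sup>2)"
      by (simp del: of_real_sum)
    also have "\<dots> \<le> ?s" by (rule finite_sum_le_has_sum[OF h]) auto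
    finally have "?s * ?s \<le> ?s * 1" by (simp add: power2_eq_square)
    then show "?s \<le> 1" using \<open>0 \<le> ?s\<close>
      by (cases "?s = 0") (simp_all only: mult_le_cancel_left_pos order_less_le, simp_all)
  qed
qed auto

text \<open>Finite combinations of rows have exactly the norm of their coefficient vector. With a
  finite set \<open>K\<close> of columns held fixed, the bound survives the limit over
  \<open>J\<close>; afterwards \<open>K\<close> is arbitrary.\<close>

lemma orthonormal_rows_contraction:
  assumes U: "orthonormal_rows U" and v: "(\<lambda>j. (cmod (v j))\<^sup>2) summable_on UNIV"
  shows "(\<lambda>j. v j * U j k) summable_on UNIV"
    and "(\<lambda>k. (cmod (\<Sum>\<^sub>\<infinity>j. v j * U j k))\<^sup>2) summable_on UNIV"
    and "(\<Sum>\<^sub>\<infinity>k. (cmod (\<Sum>\<^sub>\<infinity>j. v j * U j k))\<^sup>2) \<le> (\<Sum>\<^sub>\<infinity>j. (cmod (v j))\<^sup>2)"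
proof -
  show s: "(\<lambda>j. v j * U j k) summable_on UNIV" for k
    using cauchy_schwarz_infsum(2)[OF v orthonormal_rows_column_summable[OF U]] .
  let ?w = "\<lambda>k. \<Sum>\<^sub>\<infinity>j. v j * U j k"
  have b: "(\<Sum>k\<in>K. (cmod (?w k))\<^sup>2) \<le> (\<Sum>\<^sub>\<infinity>j. (cmod (v j))\<^sup>2)" if K: "finite K" for K
  proof (rule tendsto_upperbound)
    show "((\<lambda>J. \<Sum>k\<in>K. (cmod (\<Sum>j\<in>J. v j * U j k))\<^sup>2) \<longlongrightarrow> (\<Sum>k\<in>K. (cmod (?w k))\<^sup>2)) (finite_subsets_at_top UNIV)"
      by (intro tendsto_intros infsum_tendsto s)
    show "\<forall>\<^sub>F J in finite_subsets_at_top UNIV. (\<Sum>k\<in>K. (cmod (\<Sum>j\<in>J. v j * U j k))\<^sup>2) \<le> (\<Sum>\<^sub>\<infinity>j. (cmod (v j))\<^sup>2)"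
    proof (rule eventually_finite_subsets_at_top_weakI)
      fix J :: "nat set" assume J: "finite J"
      have "(\<Sum>k\<in>K. (cmod (\<Sum>j\<in>J. v j * U j k))\<^sup>2) \<le> (\<Sum>j\<in>J. (cmod (v j))\<^sup>2)"
        by (rule finite_sum_le_has_sum[OF orthonormal_rows_finite_combination[OF U J]]) (use K in auto)
      also have "\<dots> \<le> (\<Sum>\<^sub>\<infinity>j. (cmod (v j))\<^sup>2)"
        by (rule finite_sum_le_infsum[OF v J]) auto
      finally show "(\<Sum>k\<in>K. (cmod (\<Sum>j\<in>J. v j * U j k))\<^sup>2) \<le> (\<Sum>\<^sub>\<infinity>j. (cmod (v j))\<^sup>2)" .
    qed
  qed auto
  show w: "(\<lambda>k. (cmod (?w k))\<^sup>2) summable_on UNIV"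
    by (rule nonneg_bdd_above_summable_on) (auto intro!: bdd_aboveI2[where M="\<Sum>\<^sub>\<infinity>j. (cmod (v j))\<^sup>2"] b)
  show "(\<Sum>\<^sub>\<infinity>k. (cmod (?w k))\<^sup>2) \<le> (\<Sum>\<^sub>\<infinity>j. (cmod (v j))\<^sup>2)"
    by (rule infsum_le_finite_sums[OF w b])
qed

definition hs_sqnorm :: "fmat \<Rightarrow> real" where
  "hs_sqnorm B = (\<Sum>\<^sub>\<infinity>(k,l). (cmod (B k l))\<^sup>2)"

lemma hs_sqnorm_nonneg: "0 \<le> hs_sqnorm B"
  unfolding hs_sqnorm_def by (rule infsum_nonneg) auto

lemma hilbert_schmidt_row:
  assumes "hilbert_schmidt B"
  shows "(\<lambda>l. (cmod (B k l))\<^sup>2) summable_on UNIV"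
  using summable_on_SigmaD1[of "\<lambda>k l. (cmod (B k l))\<^sup>2" UNIV "\<lambda>_. UNIV" k] assms
  unfolding hilbert_schmidt_def by simp

lemma hilbert_schmidt_transpose:
  assumes "hilbert_schmidt B"
  shows "hilbert_schmidt (\<lambda>k l. B l k)"
  using assms summable_on_swap[of "\<lambda>(k,l). (cmod (B k l))\<^sup>2" UNIV UNIV]
  unfolding hilbert_schmidt_def by simp

lemma infsum_minus:
  fixes f g :: "'a \<Rightarrow> complex"
  assumes "f summable_on A" "g summable_on A"
  shows "(\<Sum>\<^sub>\<infinity>x\<in>A. f x - g x) = infsum f A - infsum g A"
  using infsum_add[OF assms(1), of "\<lambda>x. - g x"] assms(2) by (simp add: summable_on_uminus infsum_uminus)

lemma hilbert_schmidt_pairing: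
  assumes "hilbert_schmidt B" "hilbert_schmidt C"
  shows "(\<lambda>(i,k). cnj (B i k) * C i k) summable_on UNIV"
    and "cmod (\<Sum>\<^sub>\<infinity>(i,k). cnj (B i k) * C i k) \<le> sqrt (hs_sqnorm B) * sqrt (hs_sqnorm C)"
  using cauchy_schwarz_infsum(2,3)[of "\<lambda>(i,k). cnj (B i k)" UNIV "\<lambda>(i,k). C i k"] assms
  unfolding hilbert_schmidt_def hs_sqnorm_def by (simp_all add: case_prod_unfold)

lemma hilbert_schmidt_mult_orthonormal:
  assumes C: "hilbert_schmidt C" and U: "orthonormal_rows U"
  defines "W \<equiv> \<lambda>i k. \<Sum>\<^sub>\<infinity>j. C i j * U j k"
  shows "hilbert_schmidt W" and "hs_sqnorm W \<le> hs_sqnorm C"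
proof -
  note row = orthonormal_rows_contraction[OF U hilbert_schmidt_row[OF C]]
  have Csum: "(\<lambda>(i,j). (cmod (C i j))\<^sup>2) summable_on Sigma UNIV (\<lambda>_. UNIV)"
    using C by (simp add: hilbert_schmidt_def)
  note Ci = summable_on_Sigma_banach[OF Csum]
  have Wi: "(\<lambda>i. \<Sum>\<^sub>\<infinity>k. (cmod (W i k))\<^sup>2) summable_on UNIV"
    by (rule summable_on_comparison_test[OF Ci]) (auto simp: W_def intro!: row(3) infsum_nonneg)
  have "(\<lambda>(i,k). (cmod (W i k))\<^sup>2) summable_on Sigma UNIV (\<lambda>_. UNIV)"
    by (rule summable_on_SigmaI[OF _ Wi]) (use row(2) in \<open>auto simp: W_def\<close>)
  then show 1: "hilbert_schmidt W" by (simp add: hilbert_schmidt_def)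
  have "hs_sqnorm W = (\<Sum>\<^sub>\<infinity>i. \<Sum>\<^sub>\<infinity>k. (cmod (W i k))\<^sup>2)"
    using 1 infsum_Sigma'_banach[of "\<lambda>i k. (cmod (W i k))\<^sup>2" UNIV "\<lambda>_. UNIV"]
    by (simp add: hilbert_schmidt_def hs_sqnorm_def)
  also have "\<dots> \<le> (\<Sum>\<^sub>\<infinity>i. \<Sum>\<^sub>\<infinity>j. (cmod (C i j))\<^sup>2)"
    by (rule infsum_mono[OF Wi Ci]) (use row(3) in \<open>simp add: W_def\<close>)
  also have "\<dots> = hs_sqnorm C"
    using infsum_Sigma'_banach[OF Csum] by (simp add: hs_sqnorm_def)
  finally show "hs_sqnorm W \<le> hs_sqnorm C" .
qed

text \<open>The trace of B^dagger C U is the pairing of \<open>B\<close> with C U. Both exchanges of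
  summation rest on absolute convergence: for fixed \<open>k\<close>, from pairing \<open>C\<close>
  with the square-summable family \<open>cnj (B i k) * U j k\<close>; then from pairing
  \<open>B\<close> with C U.\<close>

lemma trace_product_eq:
  assumes B: "hilbert_schmidt B" and C: "hilbert_schmidt C" and U: "orthonormal_rows U"
  shows "(\<Sum>\<^sub>\<infinity>k. \<Sum>\<^sub>\<infinity>j. (\<Sum>\<^sub>\<infinity>i. cnj (B i k) * C i j) * U j k) =
     (\<Sum>\<^sub>\<infinity>(i,k). cnj (B i k) * (\<Sum>\<^sub>\<infinity>j. C i j * U j k))"
proof -
  note W = hilbert_schmidt_mult_orthonormal(1)[OF C U]
  have "(\<Sum>\<^sub>\<infinity>j. (\<Sum>\<^sub>\<infinity>i. cnj (B i k) * C i j) * U j k) = (\<Sum>\<^sub>\<infinity>i. cnj (B i k) * (\<Sum>\<^sub>\<infinity>j. C i j * U j k))" for k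
  proof -
    have Bk: "(\<lambda>i. (cmod (B i k))\<^sup>2) summable_on UNIV"
      using hilbert_schmidt_row[OF hilbert_schmidt_transpose[OF B]] .
    have Uk: "(\<lambda>j. (cmod (U j k))\<^sup>2) summable_on UNIV"
      by (rule orthonormal_rows_column_summable[OF U])
    have "(\<lambda>(i,j). (cmod (cnj (B i k) * U j k))\<^sup>2) summable_on Sigma UNIV (\<lambda>_. UNIV)"
    proof (rule summable_on_SigmaI)
      show "((\<lambda>j. case (i, j) of (i, j) \<Rightarrow> (cmod (cnj (B i k) * U j k))\<^sup>2) has_sum (cmod (B i k))\<^sup>2 * (\<Sum>\<^sub>\<infinity>j. (cmod (U j k))\<^sup>2)) UNIV" for i
        using has_sum_cmult_right[OF has_sum_infsum[OF Uk], of "(cmod (B i k))\<^sup>2"] by (simp add: norm_mult power_mult_distrib)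
      show "(\<lambda>i. (cmod (B i k))\<^sup>2 * (\<Sum>\<^sub>\<infinity>j. (cmod (U j k))\<^sup>2)) summable_on UNIV"
        by (rule summable_on_cmult_left[OF Bk])
    qed auto
    then have BU: "(\<lambda>x. (cmod ((\<lambda>(i,j). cnj (B i k) * U j k) x))\<^sup>2) summable_on UNIV"
      by (simp add: case_prod_unfold)
    have CC: "(\<lambda>x. (cmod ((\<lambda>(i,j). C i j) x))\<^sup>2) summable_on UNIV"
      using C by (simp add: hilbert_schmidt_def case_prod_unfold)
    have S: "(\<lambda>(i,j). cnj (B i k) * C i j * U j k) summable_on UNIV \<times> UNIV"
      using cauchy_schwarz_infsum(2)[OF BU CC] by (simp add: case_prod_unfold mult_ac)
    have "(\<Sum>\<^sub>\<infinity>j. (\<Sum>\<^sub>\<infinity>i. cnj (B i k) * C i j) * U j k) = (\<Sum>\<^sub>\<infinity>j. \<Sum>\<^sub>\<infinity>i. cnj (B i k) * C i j * U j k)"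
      by (simp add: infsum_cmult_left'[symmetric])
    also have "\<dots> = (\<Sum>\<^sub>\<infinity>i. \<Sum>\<^sub>\<infinity>j. cnj (B i k) * C i j * U j k)"
      by (rule infsum_swap_banach[OF S, symmetric])
    also have "\<dots> = (\<Sum>\<^sub>\<infinity>i. cnj (B i k) * (\<Sum>\<^sub>\<infinity>j. C i j * U j k))"
      by (simp add: infsum_cmult_right'[symmetric] mult.assoc)
    finally show ?thesis .
  qed
  then have "(\<Sum>\<^sub>\<infinity>k. \<Sum>\<^sub>\<infinity>j. (\<Sum>\<^sub>\<infinity>i. cnj (B i k) * C i j) * U j k) = (\<Sum>\<^sub>\<infinity>k. \<Sum>\<^sub>\<infinity>i. cnj (B i k) * (\<Sum>\<^sub>\<infinity>j. C i j * U j k))"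
    by simp
  also have "\<dots> = (\<Sum>\<^sub>\<infinity>i. \<Sum>\<^sub>\<infinity>k. cnj (B i k) * (\<Sum>\<^sub>\<infinity>j. C i j * U j k))"
    by (rule infsum_swap_banach[symmetric]) (use hilbert_schmidt_pairing(1)[OF B W] in simp)
  also have "\<dots> = (\<Sum>\<^sub>\<infinity>(i,k). cnj (B i k) * (\<Sum>\<^sub>\<infinity>j. C i j * U j k))"
    by (subst infsum_Sigma'_banach) (use hilbert_schmidt_pairing(1)[OF B W] in simp_all)
  finally show ?thesis .
qed

text \<open>Cutting the columns of both factors of B^dagger C leaves exactly its leading
  \<open>N\<close> by \<open>N\<close> block.\<close>

definition cut_columns :: "nat \<Rightarrow> fmat \<Rightarrow> fmat" where
  "cut_columns N B i k = (if k < N then B i k else 0)"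

lemma hilbert_schmidt_mono:
  assumes "hilbert_schmidt B" "\<And>i k. cmod (C i k) \<le> cmod (B i k)"
  shows "hilbert_schmidt C" "hs_sqnorm C \<le> hs_sqnorm B"
proof -
  have B: "(\<lambda>(k,l). (cmod (B k l))\<^sup>2) summable_on UNIV" using assms(1) by (simp add: hilbert_schmidt_def)
  have le: "(cmod (C i k))\<^sup>2 \<le> (cmod (B i k))\<^sup>2" for i k using assms(2) by (intro power_mono) auto
  have C: "(\<lambda>(k,l). (cmod (C k l))\<^sup>2) summable_on UNIV"
    by (rule summable_on_comparison_test[OF B]) (auto simp: le)
  then show "hilbert_schmidt C" by (simp add: hilbert_schmidt_def)
  show "hs_sqnorm C \<le> hs_sqnorm B" unfolding hs_sqnorm_def
    by (rule infsum_mono[OF C B]) (auto simp: le)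
qed

text \<open>A finite set of entries carries the squared norm up to \<open>e / 2\<close>; once
  \<open>N\<close> passes all its column indices, the discarded columns avoid this set.\<close>

lemma hs_sqnorm_tail:
  assumes B: "hilbert_schmidt B"
  shows "(\<lambda>N. hs_sqnorm (\<lambda>i k. B i k - cut_columns N B i k)) \<longlonglongrightarrow> 0"
proof (rule LIMSEQ_I)
  fix e :: real assume e: "e > 0"
  let ?f = "\<lambda>(k,l). (cmod (B k l))\<^sup>2"
  have S: "?f summable_on UNIV" using B by (simp add: hilbert_schmidt_def)
  obtain F where F: "finite F" "dist (sum ?f F) (infsum ?f UNIV) \<le> e / 2"
    using infsum_finite_approximation[OF S, of "e/2"] e by auto
  obtain N0 where N0: "\<And>x. x \<in> F \<Longrightarrow> snd x < N0"
    using finite_nat_set_iff_bounded[of "snd ` F"] F(1) by auto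
  have "norm (hs_sqnorm (\<lambda>i k. B i k - cut_columns N B i k) - 0) < e" if N: "N \<ge> N0" for N
  proof -
    have "hs_sqnorm (\<lambda>i k. B i k - cut_columns N B i k) = infsum ?f (UNIV - {x. snd x < N})"
      unfolding hs_sqnorm_def by (rule infsum_cong_neutral) (auto simp: cut_columns_def)
    also have "\<dots> \<le> infsum ?f (UNIV - F)"
      by (rule infsum_mono2) (use N0 N in \<open>force intro!: summable_on_subset_banach[OF S]\<close>)+
    also have "\<dots> = infsum ?f UNIV - infsum ?f F"
      by (rule infsum_Diff) (use F in \<open>auto intro!: S\<close>)
    also have "\<dots> \<le> e / 2" using F(1) abs_le_D2[OF F(2)[unfolded dist_real_def]] by simp
    finally show ?thesis using e hs_sqnorm_nonneg[of "\<lambda>i k. B i k - cut_columns N B i k"] by simp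
  qed
  then show "\<exists>N0. \<forall>N\<ge>N0. norm (hs_sqnorm (\<lambda>i k. B i k - cut_columns N B i k) - 0) < e" by blast
qed

lemma infsum_infsum_restrict:
  fixes f :: "nat \<Rightarrow> nat \<Rightarrow> complex"
  assumes "\<And>k j. N \<le> k \<or> N \<le> j \<Longrightarrow> f k j = 0"
  shows "(\<Sum>\<^sub>\<infinity>k. \<Sum>\<^sub>\<infinity>j. f k j) = (\<Sum>k<N. \<Sum>j<N. f k j)"
proof -
  have 1: "(\<Sum>\<^sub>\<infinity>j. f k j) = (\<Sum>j<N. f k j)" for k
    using infsum_cong_neutral[of "{..<N}" UNIV "f k" "f k"] assms by (force simp: not_less)
  have "(\<Sum>\<^sub>\<infinity>k. \<Sum>j<N. f k j) = (\<Sum>\<^sub>\<infinity>k\<in>{..<N}. \<Sum>j<N. f k j)"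
    by (rule infsum_cong_neutral) (use assms in \<open>auto simp: not_less\<close>)
  then show ?thesis by (simp add: 1)
qed

text \<open>Write A = B^dagger C. The error is the pairing of (\<open>B\<close> minus its cut) with
  C U, plus the pairing of the cut of \<open>B\<close> with (\<open>C\<close> minus its cut) U.
  Right multiplication by \<open>U\<close> does not increase Hilbert-Schmidt norms, so
  Cauchy-Schwarz bounds both by quantities that depend on \<open>B\<close> and \<open>C\<close>
  only.\<close>

lemma trace_class_truncation:
  assumes "trace_class A"
  obtains \<epsilon> :: "nat \<Rightarrow> real" where "\<epsilon> \<longlonglongrightarrow> 0"
    and "\<And>U N. orthonormal_rows U \<Longrightarrow>
      cmod ((\<Sum>\<^sub>\<infinity>k. \<Sum>\<^sub>\<infinity>j. A k j * U j k) - (\<Sum>k<N. \<Sum>j<N. A k j * U j k)) \<le> \<epsilon> N"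
proof -
  from assms obtain B C where B: "hilbert_schmidt B" and C: "hilbert_schmidt C"
    and A: "\<And>k l. A k l = (\<Sum>\<^sub>\<infinity>j. cnj (B j k) * C j l)" unfolding trace_class_def by blast
  define R where "R N D = (\<lambda>i k. D i k - cut_columns N D i k)" for N D
  define \<epsilon> where "\<epsilon> N = sqrt (hs_sqnorm (R N B)) * sqrt (hs_sqnorm C) + sqrt (hs_sqnorm B) * sqrt (hs_sqnorm (R N C))" for N
  have "\<epsilon> \<longlonglongrightarrow> sqrt 0 * sqrt (hs_sqnorm C) + sqrt (hs_sqnorm B) * sqrt 0"
    unfolding \<epsilon>_def R_def by (intro tendsto_intros hs_sqnorm_tail B C)
  then have "\<epsilon> \<longlonglongrightarrow> 0" by simp
  moreover have "cmod ((\<Sum>\<^sub>\<infinity>k. \<Sum>\<^sub>\<infinity>j. A k j * U j k) - (\<Sum>k<N. \<Sum>j<N. A k j * U j k)) \<le> \<epsilon> N"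
    if U: "orthonormal_rows U" for U N
  proof -
    define W where "W D = (\<lambda>i k. \<Sum>\<^sub>\<infinity>j. D i j * U j k)" for D :: fmat
    have HSW: "hilbert_schmidt (W D)" "hs_sqnorm (W D) \<le> hs_sqnorm D" if "hilbert_schmidt D" for D
      unfolding W_def using hilbert_schmidt_mult_orthonormal[OF that U] by auto
    define S where "S D E = (\<Sum>\<^sub>\<infinity>(i,k). cnj (D i k) * E i k)" for D E :: fmat
    have tr: "(\<Sum>\<^sub>\<infinity>k. \<Sum>\<^sub>\<infinity>j. (\<Sum>\<^sub>\<infinity>i. cnj (D i k) * E i j) * U j k) = S D (W E)"
      if "hilbert_schmidt D" "hilbert_schmidt E" for D E
      unfolding S_def W_def by (rule trace_product_eq[OF that U])
    have hsc: "hilbert_schmidt (cut_columns N D)" "hs_sqnorm (cut_columns N D) \<le> hs_sqnorm D"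
      if "hilbert_schmidt D" for D
      by (rule hilbert_schmidt_mono[OF that]; simp add: cut_columns_def)+
    have hsr: "hilbert_schmidt (R N D)" if "hilbert_schmidt D" for D
      by (rule hilbert_schmidt_mono[OF that]) (simp add: cut_columns_def R_def)
    have "(\<Sum>k<N. \<Sum>j<N. A k j * U j k) = (\<Sum>\<^sub>\<infinity>k. \<Sum>\<^sub>\<infinity>j. (\<Sum>\<^sub>\<infinity>i. cnj (cut_columns N B i k) * cut_columns N C i j) * U j k)"
      by (subst infsum_infsum_restrict[where N=N]) (auto simp: cut_columns_def A intro!: sum.cong)
    also have "\<dots> = S (cut_columns N B) (W (cut_columns N C))"
      by (rule tr) (use hsc B C in auto)
    finally have t2: "(\<Sum>k<N. \<Sum>j<N. A k j * U j k) = S (cut_columns N B) (W (cut_columns N C))" .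
    have t1: "(\<Sum>\<^sub>\<infinity>k. \<Sum>\<^sub>\<infinity>j. A k j * U j k) = S B (W C)" unfolding A by (rule tr[OF B C])
    have WR: "W (R N C) i k = W C i k - W (cut_columns N C) i k" for i k
    proof -
      have s: "(\<lambda>j. D i j * U j k) summable_on UNIV" if "hilbert_schmidt D" for D
        by (rule orthonormal_rows_contraction(1)[OF U hilbert_schmidt_row[OF that]])
      show ?thesis unfolding W_def R_def left_diff_distrib
        by (rule infsum_minus) (use s C hsc in auto)
    qed
    note p = hilbert_schmidt_pairing(1)
    have "S B (W C) - S (cut_columns N B) (W C) = S (R N B) (W C)"
      unfolding S_def by (subst infsum_minus[symmetric])
        (use p[OF B HSW(1)[OF C]] p[OF hsc(1)[OF B] HSW(1)[OF C]] in \<open>auto simp: R_def algebra_simps case_prod_unfold\<close>)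
    moreover have "S (cut_columns N B) (W C) - S (cut_columns N B) (W (cut_columns N C)) = S (cut_columns N B) (W (R N C))"
      unfolding S_def by (subst infsum_minus[symmetric])
        (use p[OF hsc(1)[OF B] HSW(1)[OF C]] p[OF hsc(1)[OF B] HSW(1)[OF hsc(1)[OF C]]] in \<open>auto simp: WR algebra_simps case_prod_unfold\<close>)
    ultimately have "S B (W C) - S (cut_columns N B) (W (cut_columns N C)) = S (R N B) (W C) + S (cut_columns N B) (W (R N C))"
      by (simp add: algebra_simps)
    then have "cmod (S B (W C) - S (cut_columns N B) (W (cut_columns N C))) = cmod (S (R N B) (W C) + S (cut_columns N B) (W (R N C)))"
      by simp
    also have "\<dots> \<le> sqrt (hs_sqnorm (R N B)) * sqrt (hs_sqnorm (W C)) + sqrt (hs_sqnorm (cut_columns N B)) * sqrt (hs_sqnorm (W (R N C)))"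
      unfolding S_def
      by (intro norm_triangle_le add_mono hilbert_schmidt_pairing(2) hsr hsc HSW(1) B C)
    also have "\<dots> \<le> \<epsilon> N" unfolding \<epsilon>_def
    proof (intro add_mono mult_mono)
      show "sqrt (hs_sqnorm (W C)) \<le> sqrt (hs_sqnorm C)" using HSW(2)[OF C] by simp
      show "sqrt (hs_sqnorm (cut_columns N B)) \<le> sqrt (hs_sqnorm B)" using hsc(2)[OF B] by simp
      show "sqrt (hs_sqnorm (W (R N C))) \<le> sqrt (hs_sqnorm (R N C))" using HSW(2)[OF hsr[OF C]] by simp
    qed (simp_all add: hs_sqnorm_nonneg)
    finally show ?thesis unfolding t1 t2 .
  qed
  ultimately show ?thesis by (rule that)
qed

section \<open>Laguerre integrals and uniqueness of Laguerre expansions\<close>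

lemma has_integral_power_exp:
  "((\<lambda>x::real. x ^ n * exp (- x)) has_integral fact n) {0..}"
\<comment> \<open>The integrands can differ at 0: for \<open>n = 0\<close>, \<open>0 powr 0\<close>
  is 0 while \<open>0 ^ 0\<close> is 1.\<close>
proof (rule has_integral_spike_finite[of "{0}"])
  show "((\<lambda>t. t powr (real (Suc n) - 1) / exp t) has_integral fact n) {0..}"
    using Gamma_integral_real[of "real (Suc n)"] Gamma_fact[of n, where 'a=real] by (simp add: add.commute)
qed (auto simp: powr_realpow exp_minus field_simps)

text \<open>The scaled variable \<open>u\<close> satisfies 1 + 2 x \<le> 16 (d + 1) (1 + u) \<le> 16
  (d + 1) exp u and d u \<le> x / 8; \<open>d + 1\<close> covers \<open>d = 0\<close>. The rate 1/8
  is half of the decay rate 1/4 available in \<open>laguerre_series_unique\<close>.\<close>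

lemma power_one_plus_le_exp:
  fixes x :: real
  assumes "0 \<le> x"
  shows "(1 + 2 * x) ^ d \<le> (16 * (real d + 1)) ^ d * exp (x / 8)"
proof -
  define u where "u = x / (8 * (real d + 1))"
  have xu: "x = 8 * (real d + 1) * u" and u: "0 \<le> u" using assms by (auto simp: u_def field_simps)
  have "1 + 2 * x = 1 + 16 * (real d + 1) * u" by (simp add: xu)
  also have "\<dots> \<le> 16 * (real d + 1) * (1 + u)" using u by (simp add: algebra_simps)
  also have "\<dots> \<le> 16 * (real d + 1) * exp u" using exp_ge_add_one_self[of u] by simp
  finally have "(1 + 2 * x) ^ d \<le> (16 * (real d + 1) * exp u) ^ d"
    using assms by (intro power_mono) auto
  also have "\<dots> = (16 * (real d + 1)) ^ d * exp (real d * u)"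
    by (simp add: power_mult_distrib exp_of_nat_mult)
  also have "real d * u \<le> x / 8" using u by (simp add: xu algebra_simps)
  finally show ?thesis by (simp add: mult_left_mono)
qed

text \<open>A nonzero coefficient of positive index would make the zero at the origin isolated.
  Evaluation at 0 disposes of index 0.\<close>

lemma powser_eq_0_imp_coeff_0:
  fixes a :: "nat \<Rightarrow> real"
  assumes "0 < r" and s: "\<And>z. \<bar>z\<bar> < r \<Longrightarrow> (\<lambda>n. a n * z ^ n) sums 0"
  shows "a m = 0"
proof (rule ccontr)
  assume am: "a m \<noteq> 0"
  have "a 0 = 0" using s[of 0] \<open>0 < r\<close> by simp
  with am have "m > 0" by (cases m) auto
  have sm: "\<And>x. norm (x - 0) < r \<Longrightarrow> (\<lambda>n. a n * (x - 0) ^ n) sums (0::real)" using s by simp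
  obtain t where "0 < t" and t: "\<And>z::real. z \<in> cball 0 t - {0} \<Longrightarrow> (0::real) \<noteq> 0"
    using powser_0_nonzero[OF \<open>0 < r\<close> sm refl am \<open>m > 0\<close>] by blast
  from t[of t] \<open>0 < t\<close> show False by auto
qed

text \<open>A Laguerre polynomial \<open>L\<^sub>k\<^sup>(\<^sup>d\<^sup>)\<close>, scaled by \<open>sqrt (k! / (k + d)!)\<close>.\<close>
definition lag :: "nat \<Rightarrow> nat \<Rightarrow> real \<Rightarrow> real" where
  "lag d k x = (\<Sum>q\<le>k. sqrt (fact (k + d) * fact k) / (fact (k - q) * fact (d + q) * fact q) * (- x) ^ q)"

text \<open>The Gamma integral of \<open>x ^ (d + q) * exp (- x)\<close> cancels
  \<open>fact (d + q)\<close> in \<open>lag\<close>, and a binomial sum remains. The scale \<tau>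
  thus converts the Laguerre degree \<open>k\<close> into the \<open>k\<close>-th power of
  \<open>1 - \<tau>\<close>.\<close>

lemma has_integral_lag:
  "((\<lambda>x. x ^ d * exp (- x) * lag d k (\<tau> * x)) has_integral
     sqrt (fact (k + d) * fact k) / fact k * (1 - \<tau>) ^ k) {0..}"
proof -
  define c where "c q = sqrt (fact (k + d) * fact k) / (fact (k - q) * fact (d + q) * fact q) * (- \<tau>) ^ q" for q
  have "((\<lambda>x. \<Sum>q\<le>k. c q * (x ^ (d + q) * exp (- x))) has_integral (\<Sum>q\<le>k. c q * fact (d + q))) {0..}"
    by (intro has_integral_sum has_integral_mult_right has_integral_power_exp) auto
  also have "(\<lambda>x. \<Sum>q\<le>k. c q * (x ^ (d + q) * exp (- x))) = (\<lambda>x. x ^ d * exp (- x) * lag d k (\<tau> * x))"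
    unfolding lag_def sum_distrib_left
    by (intro ext sum.cong refl) (simp add: c_def power_add power_mult_distrib power_minus[of "\<tau> * _"] power_minus[of \<tau>])
  also have "(\<Sum>q\<le>k. c q * fact (d + q)) = sqrt (fact (k + d) * fact k) / fact k * (\<Sum>q\<le>k. of_nat (k choose q) * (- \<tau>) ^ q * 1 ^ (k - q))"
    unfolding sum_distrib_left by (intro sum.cong refl) (simp add: c_def binomial_fact)
  also have "(\<Sum>q\<le>k. of_nat (k choose q) * (- \<tau>) ^ q * 1 ^ (k - q)) = (1 - \<tau>) ^ k"
    using binomial_ring[of "- \<tau>" 1 k] by simp
  finally show ?thesis .
qed

text \<open>The hypothesis at r^2 = \<tau> x, integrated against an integrable weight in x, bounds
  the partial sums of a power series in z = 1 - \<tau> by a multiple of \<open>\<delta> N\<close>.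
  For |z| < 1/2 the series therefore converges, with value 0, and its coefficients vanish.\<close>

lemma laguerre_series_unique:
  fixes e \<delta> :: "nat \<Rightarrow> real"
  assumes \<delta>: "\<delta> \<longlonglongrightarrow> 0"
    and le: "\<And>N r. 0 \<le> r \<Longrightarrow> \<bar>\<Sum>k<N. e k * (exp (- (r\<^sup>2 / 2)) * r ^ d * lag d k (r\<^sup>2))\<bar> \<le> \<delta> N"
  shows "e m = 0"
proof -
  define w where "w k = sqrt (fact (k + d) * fact k) / (fact k :: real)" for k
  \<comment> \<open>\<open>K\<close> is the integral of
    \<open>(16 * (real d + 1)) ^ d * exp (- x / 8)\<close> over x \<ge> 0.\<close>
  define K where "K = 8 * (16 * (real d + 1)) ^ d"
  have \<delta>0: "0 \<le> \<delta> N" for N using le[of 0 N] by linarith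
  have b: "\<bar>\<tau> ^ d * (\<Sum>k<N. e k * w k * (1 - \<tau>) ^ k)\<bar> \<le> \<delta> N * K" if \<tau>: "0 < \<tau>" "\<tau> \<le> 3 / 2" for \<tau> N
  proof -
    define G where "G x = \<tau> ^ d * (\<Sum>k<N. e k * (x ^ d * exp (- x) * lag d k (\<tau> * x)))" for x
    define J where "J = \<tau> ^ d * (\<Sum>k<N. e k * (w k * (1 - \<tau>) ^ k))"
    have G: "(G has_integral J) {0..}"
      unfolding G_def J_def w_def by (intro has_integral_mult_right has_integral_sum has_integral_lag) auto
    have H: "((\<lambda>x. \<delta> N * ((16 * (real d + 1)) ^ d * exp (- (1/8) * x))) has_integral \<delta> N * ((16 * (real d + 1)) ^ d * (exp (- (1/8) * 0) / (1/8)))) {0..}"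
      by (intro has_integral_mult_right has_integral_exp_minus_to_infinity) auto
    have GH: "\<bar>G x\<bar> \<le> \<delta> N * ((16 * (real d + 1)) ^ d * exp (- (1/8) * x))" if x: "0 \<le> x" for x
    proof -
      define r where "r = sqrt (\<tau> * x)"
      have r2: "r\<^sup>2 = \<tau> * x" and r: "0 \<le> r" using x \<tau> by (auto simp: r_def)
      define F where "F = (\<Sum>k<N. e k * (exp (- (r\<^sup>2 / 2)) * r ^ d * lag d k (r\<^sup>2)))"
      have "G x = (\<Sum>k<N. e k * ((\<tau> * x) ^ d * exp (- x) * lag d k (r\<^sup>2)))"
        unfolding G_def sum_distrib_left r2 by (simp add: power_mult_distrib mult_ac)
      \<comment> \<open>One factor \<open>r ^ d\<close> and \<open>exp (- (r\<^sup>2 / 2))\<close>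
        go into \<open>F\<close>, to which the hypothesis applies; what is left has to be dominated
        by an integrable function.\<close>
      also have "(\<tau> * x) ^ d = r ^ d * r ^ d" by (simp add: r2[symmetric] power2_eq_square power_mult_distrib)
      also have "exp (- x) = exp (- (x - r\<^sup>2 / 2)) * exp (- (r\<^sup>2 / 2))" by (simp add: exp_add[symmetric])
      finally have "G x = r ^ d * exp (- (x - r\<^sup>2 / 2)) * F"
        unfolding F_def sum_distrib_left by (simp add: mult_ac)
      then have "\<bar>G x\<bar> = r ^ d * exp (- (x - r\<^sup>2 / 2)) * \<bar>F\<bar>" using r by (simp add: abs_mult)
      also have "\<dots> \<le> ((16 * (real d + 1)) ^ d * exp (x / 8)) * exp (- (x / 4)) * \<delta> N"
      proof (intro mult_mono)
        have "0 \<le> (r - 1)\<^sup>2" by simp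
        then have "r \<le> 1 + \<tau> * x" using r by (simp add: power2_diff r2)
        moreover have "\<tau> * x \<le> 2 * x" using \<tau> x by (intro mult_right_mono) auto
        ultimately have "r \<le> 1 + 2 * x" by linarith
        then have "r ^ d \<le> (1 + 2 * x) ^ d" using r by (intro power_mono)
        then show "r ^ d \<le> (16 * (real d + 1)) ^ d * exp (x / 8)" using power_one_plus_le_exp[OF x, of d] by linarith
        \<comment> \<open>The bound \<tau> \<le> 3/2 yields x - r^2 / 2 \<ge> x / 4, which keeps
          enough decay to absorb \<open>r ^ d\<close>.\<close>
        have "\<tau> * x \<le> 3 / 2 * x" using \<tau> x by (intro mult_right_mono) auto
        then show "exp (- (x - r\<^sup>2 / 2)) \<le> exp (- (x / 4))" by (simp add: r2)
        show "\<bar>F\<bar> \<le> \<delta> N" unfolding F_def by (rule le[OF r])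
      qed (use r in auto)
      also have "\<dots> = \<delta> N * ((16 * (real d + 1)) ^ d * (exp (x / 8) * exp (- (x / 4))))" by simp
      also have "exp (x / 8) * exp (- (x / 4)) = exp (- (1/8) * x)" by (simp add: exp_add[symmetric])
      finally show ?thesis .
    qed
    have "J \<le> \<delta> N * ((16 * (real d + 1)) ^ d * (exp (- (1/8) * 0) / (1/8)))"
      by (rule has_integral_le[OF G H]) (use GH in fastforce)
    moreover have "- J \<le> \<delta> N * ((16 * (real d + 1)) ^ d * (exp (- (1/8) * 0) / (1/8)))"
      by (rule has_integral_le[OF has_integral_neg[OF G] H]) (use GH in fastforce)
    ultimately have "\<bar>J\<bar> \<le> \<delta> N * K" by (simp add: K_def abs_le_iff)
    then show ?thesis by (simp add: J_def mult.assoc)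
  qed
  have "(\<lambda>k. (e k * w k) * z ^ k) sums 0" if z: "\<bar>z\<bar> < 1 / 2" for z
  proof -
    define \<tau> where "\<tau> = 1 - z"
    have \<tau>: "0 < \<tau>" "\<tau> \<le> 3 / 2" "1 - \<tau> = z" using z by (auto simp: \<tau>_def)
    have "(\<lambda>N. \<tau> ^ d * (\<Sum>k<N. e k * w k * z ^ k)) \<longlonglongrightarrow> 0"
    proof (rule Lim_null_comparison)
      show "\<forall>\<^sub>F N in sequentially. norm (\<tau> ^ d * (\<Sum>k<N. e k * w k * z ^ k)) \<le> \<delta> N * K"
        using b[OF \<tau>(1,2)] by (simp add: \<tau>(3))
      show "(\<lambda>N. \<delta> N * K) \<longlonglongrightarrow> 0" using tendsto_mult_right[OF \<delta>, of K] by simp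
    qed
    from tendsto_mult_left[OF this, of "1 / \<tau> ^ d"] show ?thesis
      using \<tau>(1) by (simp add: sums_def)
  qed
  then have "e m * w m = 0" by (intro powser_eq_0_imp_coeff_0[of "1/2" "\<lambda>k. e k * w k" m]) auto
  then show ?thesis by (simp add: w_def)
qed

section \<open>The Wigner function determines the operator\<close>

lemma sum_cis_roots_of_unity:
  fixes n :: int
  assumes "\<bar>n\<bar> < int M"
  shows "(\<Sum>m<M. cis (2 * pi * real m / real M * of_int n)) = (if n = 0 then of_nat M else 0)"
proof (cases "n = 0")
  case False
  define z where "z = cis (2 * pi * of_int n / real M)"
  have M: "M > 0" using assms by auto
  have p: "cis (2 * pi * real m / real M * of_int n) = z ^ m" for m
  proof -
    have "2 * pi * real m / real M * of_int n = real m * (2 * pi * of_int n / real M)" by simp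
    then show ?thesis unfolding z_def by (simp only: Complex.DeMoivre)
  qed
  \<comment> \<open>\<open>z = 1\<close> would make \<open>n\<close> a multiple of \<open>M\<close>,
    which the bound on \<open>n\<close> permits only for 0.\<close>
  have "z \<noteq> 1"
  proof
    assume "z = 1"
    then obtain i :: int where "2 * pi * of_int n / real M = of_int i * (2 * pi)"
      unfolding z_def cis_eq_1_iff by blast
    then have "real_of_int n = of_int (i * int M)" using M by (simp add: field_simps)
    then have "n = i * int M" by (simp only: of_int_eq_iff)
    then have "int M dvd n" by simp
    then show False using assms False zdvd_imp_le[of "int M" "\<bar>n\<bar>"] by auto
  qed
  moreover have "z ^ M = 1"
  proof -
    have "z ^ M = cis (2 * pi * of_int n)" unfolding z_def by (subst Complex.DeMoivre) (use M in simp)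
    then show ?thesis by simp
  qed
  ultimately have "(\<Sum>m<M. z ^ m) = 0" by (simp add: geometric_sum)
  then show ?thesis using False by (simp only: p if_False)
qed auto

text \<open>Rotation covariance: rotating the amplitude conjugates D by exp(i \<theta> n), with n
  the number operator, so all entries with the same \<open>j - k\<close> acquire the same
  phase.\<close>

lemma disp_cis:
  "disp (of_real r * cis \<theta>) j k = cis (\<theta> * of_int (int j - int k)) * disp (of_real r) j k"
proof -
  have c: "cis (\<theta> * of_int (int j - int k)) = cis \<theta> ^ j * cnj (cis \<theta>) ^ k"
  proof -
    have "cis (\<theta> * of_int (int j - int k)) = cis (real j * \<theta> + real k * (- \<theta>))" by (simp add: algebra_simps)
    then show ?thesis by (simp only: cis_mult[symmetric] Complex.DeMoivre[symmetric] cis_cnj)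
  qed
  have "cis (\<theta> * of_int (int j - int k)) * (of_real r ^ (j - p) * (- of_real r) ^ (k - p)) =
     (of_real r * cis \<theta>) ^ (j - p) * (- cnj (of_real r * cis \<theta>)) ^ (k - p)" if "p \<le> min j k" for p
  proof -
    have "cis \<theta> ^ j * cnj (cis \<theta>) ^ k = (cis \<theta> ^ (j - p) * cis \<theta> ^ p) * (cnj (cis \<theta>) ^ (k - p) * cnj (cis \<theta>) ^ p)"
      using that by (simp flip: power_add)
    also have "\<dots> = cis \<theta> ^ (j - p) * cnj (cis \<theta>) ^ (k - p) * (cis \<theta> * cnj (cis \<theta>)) ^ p"
      by (simp add: power_mult_distrib)
    also have "cis \<theta> * cnj (cis \<theta>) = 1" by (simp add: cis_cnj cis_mult)
    finally show ?thesis unfolding c by (simp add: power_mult_distrib power_minus[of "of_real r"] power_minus[of "of_real r * cnj (cis \<theta>)"])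
  qed
  then have "cis (\<theta> * of_int (int j - int k)) * (c * of_real r ^ (j - p) * (- of_real r) ^ (k - p)) =
     c * (of_real r * cis \<theta>) ^ (j - p) * (- cnj (of_real r * cis \<theta>)) ^ (k - p)" if "p \<in> {..min j k}" for p c
    using that by (simp only: mult.assoc mult.left_commute[of _ c] atMost_iff)
  note entry = this
  have n: "cmod (of_real r * cis \<theta>) = cmod (of_real r)" by (simp add: norm_mult)
  show ?thesis
    unfolding disp_def mult.left_commute[of "cis _" "exp _"] sum_distrib_left[of "cis _"] n complex_cnj_complex_of_real
    by (rule arg_cong2[where f = "(*)", OF refl sum.cong[OF refl]]) (simp only: entry)
qed

text \<open>The sum is reversed by \<open>q = k - p\<close>. The excess \<open>d\<close> of creation
  over annihilation gives the factor \<open>r ^ d\<close>, and the rest is a polynomial in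
  r^2.\<close>

lemma disp_of_real:
  "disp (of_real r) (k + d) k = of_real (exp (- (r\<^sup>2 / 2)) * r ^ d * lag d k (r\<^sup>2))"
proof -
  have "(\<Sum>p\<le>min (k + d) k. complex_of_real (sqrt (fact (k + d) * fact k) / (fact p * fact (k + d - p) * fact (k - p)))
        * of_real r ^ (k + d - p) * (- cnj (of_real r)) ^ (k - p))
    = (\<Sum>q\<le>k. complex_of_real (r ^ d * (sqrt (fact (k + d) * fact k) / (fact (k - q) * fact (d + q) * fact q) * (- r\<^sup>2) ^ q)))"
  proof (rule sum.reindex_bij_witness[of _ "\<lambda>q. k - q" "\<lambda>p. k - p"])
    fix p assume p: "p \<in> {..min (k + d) k}"
    then have 1: "k + d - p = d + (k - p)" "k - (k - p) = p" by auto
    have 2: "(- r\<^sup>2) ^ (k - p) = r ^ (k - p) * (- r) ^ (k - p)"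
      by (simp add: power_mult_distrib[symmetric] power2_eq_square)
    have "- cnj (of_real r) = complex_of_real (- r)" by simp
    then have "complex_of_real (sqrt (fact (k + d) * fact k) / (fact p * fact (k + d - p) * fact (k - p)))
        * of_real r ^ (k + d - p) * (- cnj (of_real r)) ^ (k - p)
      = complex_of_real (sqrt (fact (k + d) * fact k) / (fact p * fact (k + d - p) * fact (k - p)) * r ^ (k + d - p) * (- r) ^ (k - p))"
      by (simp only: of_real_mult of_real_power)
    also have "\<dots> = complex_of_real (r ^ d * (sqrt (fact (k + d) * fact k) / (fact (k - (k - p)) * fact (d + (k - p)) * fact (k - p)) * (- r\<^sup>2) ^ (k - p)))"
      unfolding 1 2 power_add by (simp only: mult_ac)
    finally show "complex_of_real (r ^ d * (sqrt (fact (k + d) * fact k) / (fact (k - (k - p)) * fact (d + (k - p)) * fact (k - p)) * (- r\<^sup>2) ^ (k - p)))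
      = complex_of_real (sqrt (fact (k + d) * fact k) / (fact p * fact (k + d - p) * fact (k - p)))
        * of_real r ^ (k + d - p) * (- cnj (of_real r)) ^ (k - p)" ..
  qed auto
  note s = this
  show ?thesis
    unfolding disp_def s of_real_sum[symmetric] norm_of_real power2_abs of_real_minus[symmetric] exp_of_real of_real_mult[symmetric]
    by (simp only: lag_def sum_distrib_left mult.assoc)
qed

text \<open>The truncation bound is applied to both operators, a discrete Fourier sum separates the
  off-diagonals, and \<open>laguerre_series_unique\<close> handles the real and imaginary parts
  along each of them. This covers the entries on and above the diagonal; hermiticity gives the
  others.\<close>

lemma wigner_injective:
  assumes A: "hermitian_op A" "trace_class A" and B: "hermitian_op B" "trace_class B"
    and eq: "\<And>\<alpha>. wigner A \<alpha> = wigner B \<alpha>"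
  shows "A = B"
proof -
  define U where "U \<gamma> = (\<lambda>j k. (-1) ^ k * disp \<gamma> j k)" for \<gamma>
  have U: "orthonormal_rows (U \<gamma>)" for \<gamma>
    unfolding orthonormal_rows_def
  proof (intro allI)
    fix i j
    have "U \<gamma> i k * cnj (U \<gamma> j k) = disp \<gamma> i k * cnj (disp \<gamma> j k)" for k
    proof -
      have "(-1) ^ k * (-1) ^ k = (1::complex)" by (simp flip: power_mult_distrib)
      then show ?thesis by (simp add: U_def mult_ac)
    qed
    then show "((\<lambda>k. U \<gamma> i k * cnj (U \<gamma> j k)) has_sum (if i = j then 1 else 0)) UNIV"
      using disp_rows_orthonormal[of \<gamma> i j] by simp
  qed
  \<comment> \<open>Halving the argument undoes the doubling in
    \<open>disp_parity_eq\<close>.\<close>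
  have W: "wigner X (\<gamma> / 2) = complex_of_real (2 / pi) * (\<Sum>\<^sub>\<infinity>k. \<Sum>\<^sub>\<infinity>j. X k j * U \<gamma> j k)" for X \<gamma>
    unfolding wigner_def disp_parity_eq U_def by simp
  obtain \<epsilon>A where \<epsilon>A: "\<epsilon>A \<longlonglongrightarrow> 0" "\<And>U N. orthonormal_rows U \<Longrightarrow>
      cmod ((\<Sum>\<^sub>\<infinity>k. \<Sum>\<^sub>\<infinity>j. A k j * U j k) - (\<Sum>k<N. \<Sum>j<N. A k j * U j k)) \<le> \<epsilon>A N"
    by (rule trace_class_truncation[OF A(2)]) (rule that)
  obtain \<epsilon>B where \<epsilon>B: "\<epsilon>B \<longlonglongrightarrow> 0" "\<And>U N. orthonormal_rows U \<Longrightarrow>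
      cmod ((\<Sum>\<^sub>\<infinity>k. \<Sum>\<^sub>\<infinity>j. B k j * U j k) - (\<Sum>k<N. \<Sum>j<N. B k j * U j k)) \<le> \<epsilon>B N"
    by (rule trace_class_truncation[OF B(2)]) (rule that)
  define E where "E k j = A k j - B k j" for k j
  define \<delta> where "\<delta> N = \<epsilon>A N + \<epsilon>B N" for N
  have \<delta>: "\<delta> \<longlonglongrightarrow> 0" unfolding \<delta>_def using tendsto_add[OF \<epsilon>A(1) \<epsilon>B(1)] by simp
  \<comment> \<open>The full traces of \<open>A\<close> and \<open>B\<close> agree, so the truncated
    trace of \<open>E\<close> is a difference of two truncation errors.\<close>
  have trunc: "cmod (\<Sum>k<N. \<Sum>j<N. E k j * U \<gamma> j k) \<le> \<delta> N" for N \<gamma>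
  proof -
    have AB: "(\<Sum>\<^sub>\<infinity>k. \<Sum>\<^sub>\<infinity>j. A k j * U \<gamma> j k) = (\<Sum>\<^sub>\<infinity>k. \<Sum>\<^sub>\<infinity>j. B k j * U \<gamma> j k)" (is "?a = ?b")
      using eq[of "\<gamma> / 2"] unfolding W by simp
    have "cmod (\<Sum>k<N. \<Sum>j<N. E k j * U \<gamma> j k) = cmod (
       (?b - (\<Sum>k<N. \<Sum>j<N. B k j * U \<gamma> j k)) - (?a - (\<Sum>k<N. \<Sum>j<N. A k j * U \<gamma> j k)))"
      unfolding AB by (simp add: E_def left_diff_distrib sum_subtractf)
    also have "\<dots> \<le> cmod (?b - (\<Sum>k<N. \<Sum>j<N. B k j * U \<gamma> j k)) + cmod (?a - (\<Sum>k<N. \<Sum>j<N. A k j * U \<gamma> j k))"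
      by (rule norm_triangle_ineq4)
    also have "\<dots> \<le> \<delta> N" unfolding \<delta>_def using \<epsilon>A(2)[OF U, of \<gamma> N] \<epsilon>B(2)[OF U, of \<gamma> N] by linarith
    finally show ?thesis .
  qed
  have diag: "cmod (\<Sum>k<N. E k (k + d) * U (of_real r) (k + d) k) \<le> \<delta> (N + d)" for N d r
  proof -
    \<comment> \<open>In a block of size \<open>N + d\<close>, the entries with
      \<open>j = k + d\<close> are exactly those with \<open>k < N\<close>. \<open>M\<close> exceeds
      every frequency |j - k - d| in the block, so averaging over \<open>M\<close> equally spaced
      phases isolates them exactly.\<close>
    define L where "L = N + d"
    define M where "M = L + d + 1"
    have M: "M > 0" by (simp add: M_def)
    define \<theta> where "\<theta> m = 2 * pi * real m / real M" for m
    define T where "T m = (\<Sum>k<L. \<Sum>j<L. E k j * U (of_real r * cis (\<theta> m)) j k)" for m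
    have T: "T m = (\<Sum>k<L. \<Sum>j<L. (E k j * U (of_real r) j k) * cis (\<theta> m * of_int (int j - int k)))" for m
      unfolding T_def U_def disp_cis by (simp add: mult_ac)
    have "(\<Sum>m<M. cis (- (\<theta> m * real d)) * T m)
      = (\<Sum>m<M. \<Sum>k<L. \<Sum>j<L. (E k j * U (of_real r) j k) * cis (\<theta> m * of_int (int j - int k - int d)))"
      unfolding T sum_distrib_left
      by (intro sum.cong refl) (simp add: mult.left_commute[of "cis (- _)"] cis_mult algebra_simps)
    also have "\<dots> = (\<Sum>k<L. \<Sum>m<M. \<Sum>j<L. (E k j * U (of_real r) j k) * cis (\<theta> m * of_int (int j - int k - int d)))"
      by (rule sum.swap)
    also have "\<dots> = (\<Sum>k<L. \<Sum>j<L. \<Sum>m<M. (E k j * U (of_real r) j k) * cis (\<theta> m * of_int (int j - int k - int d)))"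
      by (rule sum.cong[OF refl], rule sum.swap)
    also have "\<dots> = (\<Sum>k<L. \<Sum>j<L. (E k j * U (of_real r) j k) * (if j = k + d then of_nat M else 0))"
    proof (intro sum.cong refl)
      fix k j assume kj: "k \<in> {..<L}" "j \<in> {..<L}"
      then have "\<bar>int j - int k - int d\<bar> < int M" by (auto simp: M_def)
      from sum_cis_roots_of_unity[OF this]
      show "(\<Sum>m<M. (E k j * U (of_real r) j k) * cis (\<theta> m * of_int (int j - int k - int d)))
         = (E k j * U (of_real r) j k) * (if j = k + d then of_nat M else 0)"
        by (simp add: sum_distrib_left[symmetric] \<theta>_def)
    qed
    also have "\<dots> = (\<Sum>k<L. if k < N then of_nat M * (E k (k + d) * U (of_real r) (k + d) k) else 0)"
      by (intro sum.cong refl) (auto simp: L_def if_distrib cong: if_cong)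
    also have "\<dots> = (\<Sum>k<N. of_nat M * (E k (k + d) * U (of_real r) (k + d) k))"
      by (rule sum.mono_neutral_cong_right) (auto simp: L_def)
    also have "\<dots> = of_nat M * (\<Sum>k<N. E k (k + d) * U (of_real r) (k + d) k)"
      by (simp add: sum_distrib_left)
    finally have "real M * cmod (\<Sum>k<N. E k (k + d) * U (of_real r) (k + d) k) = cmod (\<Sum>m<M. cis (- (\<theta> m * real d)) * T m)"
      by (simp add: norm_mult)
    also have "\<dots> \<le> (\<Sum>m<M. \<delta> L)"
      by (rule sum_norm_le) (simp add: norm_mult T_def trunc)
    finally show ?thesis using M by (simp add: L_def)
  qed
  have upper: "E m (m + d) = 0" for m d
  proof -
    define c where "c k r = exp (- (r\<^sup>2 / 2)) * r ^ d * lag d k (r\<^sup>2)" for k r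
    have Re_scale: "Re (of_real a * z) = a * Re z" and Im_scale: "Im (of_real a * z) = a * Im z" for a z by simp_all
    have S: "(\<Sum>k<N. E k (k + d) * U (of_real r) (k + d) k) = (\<Sum>k<N. of_real ((-1) ^ k * c k r) * E k (k + d))" for N r
      by (simp add: U_def disp_of_real c_def mult_ac)
    have d: "(\<lambda>N. \<delta> (N + d)) \<longlonglongrightarrow> 0" using \<delta> by (rule LIMSEQ_ignore_initial_segment)
    have "Re (E m (m + d)) * (-1) ^ m = 0"
    proof (rule laguerre_series_unique[OF d, where e = "\<lambda>k. Re (E k (k + d)) * (-1) ^ k"])
      fix N and r :: real
      have "(\<Sum>k<N. Re (E k (k + d)) * (-1) ^ k * c k r) = Re (\<Sum>k<N. of_real ((-1) ^ k * c k r) * E k (k + d))"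
        unfolding Re_sum by (intro sum.cong refl) (simp only: Re_scale, simp only: mult_ac)
      then show "\<bar>\<Sum>k<N. Re (E k (k + d)) * (-1) ^ k * (exp (- (r\<^sup>2 / 2)) * r ^ d * lag d k (r\<^sup>2))\<bar> \<le> \<delta> (N + d)"
        using order_trans[OF abs_Re_le_cmod diag[where N=N and d=d and r=r, unfolded S]] by (simp only: c_def)
    qed
    moreover have "Im (E m (m + d)) * (-1) ^ m = 0"
    proof (rule laguerre_series_unique[OF d, where e = "\<lambda>k. Im (E k (k + d)) * (-1) ^ k"])
      fix N and r :: real
      have "(\<Sum>k<N. Im (E k (k + d)) * (-1) ^ k * c k r) = Im (\<Sum>k<N. of_real ((-1) ^ k * c k r) * E k (k + d))"
        unfolding Im_sum by (intro sum.cong refl) (simp only: Im_scale, simp only: mult_ac)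
      then show "\<bar>\<Sum>k<N. Im (E k (k + d)) * (-1) ^ k * (exp (- (r\<^sup>2 / 2)) * r ^ d * lag d k (r\<^sup>2))\<bar> \<le> \<delta> (N + d)"
        using order_trans[OF abs_Im_le_cmod diag[where N=N and d=d and r=r, unfolded S]] by (simp only: c_def)
    qed
    ultimately show ?thesis by (simp add: complex_eq_iff)
  qed
  have "A i j = B i j" for i j
  proof (cases "i \<le> j")
    case True
    then show ?thesis using upper[of i "j - i"] by (simp add: E_def)
  next
    case False
    then have "A j i = B j i" using upper[of j "i - j"] by (simp add: E_def)
    then show ?thesis using A(1) B(1) unfolding hermitian_op_def by metis
  qed
  then show ?thesis by (intro ext)
qed

section \<open>Phase-invariant operators as polynomials\<close>

lemma supported_upto_trace_class:
  assumes "supported_upto n A"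
  shows "trace_class A"
proof -
  have A0: "A k l = 0" if "n < k \<or> n < l" for k l using assms that unfolding supported_upto_def by blast
  \<comment> \<open>\<open>P\<close> is the projection onto the first \<open>n + 1\<close> Fock
    states; A = P A is then a product of two Hilbert-Schmidt matrices.\<close>
  define P where "P = (\<lambda>j k. if j = k \<and> k \<le> n then 1 else 0 :: complex)"
  have fin: "hilbert_schmidt B" if "\<And>k l. n < k \<or> n < l \<Longrightarrow> B k l = 0" for B
    unfolding hilbert_schmidt_def
    by (rule finite_nonzero_values_imp_summable_on, rule finite_subset[of _ "{..n} \<times> {..n}"])
      (use that in \<open>auto simp: not_less[symmetric]\<close>)
  have "A k l = (\<Sum>\<^sub>\<infinity>j. cnj (P j k) * A j l)" for k l
  proof -
    have "(\<Sum>\<^sub>\<infinity>j. cnj (P j k) * A j l) = (\<Sum>\<^sub>\<infinity>j\<in>{k}. cnj (P j k) * A j l)"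
      by (rule infsum_cong_neutral) (auto simp: P_def)
    then show ?thesis using A0 by (auto simp: P_def)
  qed
  moreover have "hilbert_schmidt P" "hilbert_schmidt A" by (rule fin; force simp: P_def A0)+
  ultimately show ?thesis unfolding trace_class_def by blast
qed

text \<open>On the diagonal the phase of the displacement drops out by \<open>disp_cis\<close>. The
  displacement 2 \<alpha> accounts for the exponent 2 |\<alpha>|^2 and the argument 4
  |\<alpha>|^2.\<close>

lemma disp_parity_diag:
  "disp_parity \<alpha> k k = of_real ((-1) ^ k * exp (- 2 * (cmod \<alpha>)\<^sup>2) * lag 0 k (4 * (cmod \<alpha>)\<^sup>2))"
proof -
  have "2 * \<alpha> = of_real (2 * cmod \<alpha>) * cis (Arg \<alpha>)"
    using rcis_cmod_Arg[of \<alpha>] by (simp add: rcis_def)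
  then have "disp (2 * \<alpha>) k k = disp (of_real (2 * cmod \<alpha>)) (k + 0) k"
    by (simp only: disp_cis) simp
  then have "disp (2 * \<alpha>) k k = of_real (exp (- 2 * (cmod \<alpha>)\<^sup>2) * lag 0 k (4 * (cmod \<alpha>)\<^sup>2))"
    unfolding disp_of_real by (simp add: power_mult_distrib)
  then show ?thesis by (simp add: disp_parity_eq)
qed

lemma wigner_phase_invariant:
  assumes "supported_upto n A" "phase_invariant A"
  shows "wigner A \<alpha> = of_real (2 / pi * exp (- 2 * (cmod \<alpha>)\<^sup>2)) * (\<Sum>k\<le>n. A k k * of_real ((-1) ^ k * lag 0 k (4 * (cmod \<alpha>)\<^sup>2)))"
proof -
  have "(\<Sum>\<^sub>\<infinity>k. \<Sum>\<^sub>\<infinity>j. A k j * disp_parity \<alpha> j k) = (\<Sum>k<Suc n. \<Sum>j<Suc n. A k j * disp_parity \<alpha> j k)"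
    by (rule infsum_infsum_restrict) (use assms(1) in \<open>auto simp: supported_upto_def\<close>)
  also have "\<dots> = (\<Sum>k<Suc n. \<Sum>j<Suc n. if j = k then A k k * disp_parity \<alpha> k k else 0)"
    by (intro sum.cong refl) (use assms(2) in \<open>auto simp: phase_invariant_def\<close>)
  also have "\<dots> = (\<Sum>k\<le>n. A k k * disp_parity \<alpha> k k)"
    by (simp add: lessThan_Suc_atMost)
  also have "\<dots> = of_real (exp (- 2 * (cmod \<alpha>)\<^sup>2)) * (\<Sum>k\<le>n. A k k * of_real ((-1) ^ k * lag 0 k (4 * (cmod \<alpha>)\<^sup>2)))"
    unfolding disp_parity_diag sum_distrib_left of_real_mult by (intro sum.cong refl) (simp only: mult_ac)
  finally show ?thesis unfolding wigner_def by simp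
qed

lemma lag_0_binomial: "lag 0 k x = (\<Sum>q\<le>k. of_nat (k choose q) * (- x) ^ q / fact q)"
  unfolding lag_def by (intro sum.cong refl) (simp add: binomial_fact)

text \<open>\<open>choose_mult\<close> takes out the factor \<open>j choose q\<close>; what remains
  is the alternating sum of row \<open>j - q\<close> of Pascal's triangle, which vanishes unless
  \<open>q = j\<close>.\<close>

lemma alternating_choose_choose:
  "(\<Sum>k\<le>j. (-1) ^ k * of_nat (j choose k) * of_nat (k choose q)) = (if q = j then (-1) ^ j else 0 :: 'a::comm_ring_1)"
proof (cases "q \<le> j")
  case True
  have "(\<Sum>k\<le>j. (-1) ^ k * of_nat (j choose k) * of_nat (k choose q))
      = (\<Sum>k=q..j. (-1) ^ k * of_nat (j choose k) * (of_nat (k choose q) :: 'a))"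
    by (rule sum.mono_neutral_right) (auto simp: not_le binomial_eq_0)
  also have "\<dots> = (\<Sum>i\<le>j - q. (-1) ^ q * of_nat (j choose q) * ((-1) ^ i * of_nat ((j - q) choose i)))"
  proof (rule sum.reindex_bij_witness[of _ "\<lambda>i. i + q" "\<lambda>k. k - q"])
    fix k assume k: "k \<in> {q..j}"
    then have "(j choose k) * (k choose q) = (j choose q) * ((j - q) choose (k - q))"
      by (simp add: choose_mult)
    then have A: "of_nat (j choose k) * of_nat (k choose q) = (of_nat (j choose q) * of_nat ((j - q) choose (k - q)) :: 'a)"
      by (simp flip: of_nat_mult)
    have E: "(-1) ^ k = (-1) ^ q * ((-1) ^ (k - q) :: 'a)" using k by (simp flip: power_add)
    show "(-1) ^ q * of_nat (j choose q) * ((-1) ^ (k - q) * of_nat ((j - q) choose (k - q)))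
      = (-1) ^ k * of_nat (j choose k) * (of_nat (k choose q) :: 'a)"
      by (simp only: mult.assoc A E mult.left_commute[of "of_nat (j choose q)"])
  qed (use True in auto)
  also have "\<dots> = (-1) ^ q * of_nat (j choose q) * (\<Sum>i\<le>j - q. (-1) ^ i * of_nat ((j - q) choose i))"
    by (simp add: sum_distrib_left)
  also have "\<dots> = (if q = j then (-1) ^ j else 0)"
    using True choose_alternating_sum[of "j - q", where 'a='a] by auto
  finally show ?thesis .
next
  case False
  then show ?thesis by (auto simp: binomial_eq_0 intro!: sum.neutral)
qed

text \<open>Only the top power survives \<open>alternating_choose_choose\<close>. The signs are the
  parities of the Fock states, which is why a binomial state has a monomial Wigner
  polynomial.\<close>

lemma alternating_choose_lag:
  "(\<Sum>k\<le>j. (-1) ^ k * of_nat (j choose k) * lag 0 k x) = x ^ j / fact j"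
proof -
  have "(\<Sum>k\<le>j. (-1) ^ k * of_nat (j choose k) * lag 0 k x)
     = (\<Sum>k\<le>j. \<Sum>q\<le>j. ((-1) ^ k * of_nat (j choose k) * of_nat (k choose q)) * ((- x) ^ q / fact q))"
  proof (intro sum.cong refl)
    fix k assume k: "k \<in> {..j}"
    have "lag 0 k x = (\<Sum>q\<le>j. of_nat (k choose q) * (- x) ^ q / fact q)"
      unfolding lag_0_binomial by (rule sum.mono_neutral_left) (use k in auto)
    then show "(-1) ^ k * of_nat (j choose k) * lag 0 k x = (\<Sum>q\<le>j. ((-1) ^ k * of_nat (j choose k) * of_nat (k choose q)) * ((- x) ^ q / fact q))"
      by (simp add: sum_distrib_left mult.assoc)
  qed
  also have "\<dots> = (\<Sum>q\<le>j. \<Sum>k\<le>j. ((-1) ^ k * of_nat (j choose k) * of_nat (k choose q)) * ((- x) ^ q / fact q))"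
    by (rule sum.swap)
  also have "\<dots> = (\<Sum>q\<le>j. (if q = j then (-1) ^ j else 0) * ((- x) ^ q / fact q))"
    by (simp only: sum_distrib_right[symmetric] alternating_choose_choose)
  also have "\<dots> = (\<Sum>q\<le>j. if q = j then (-1) ^ j * (- x) ^ j / fact j else 0)"
    by (intro sum.cong) auto
  also have "\<dots> = x ^ j / fact j" by (simp add: power_mult_distrib[symmetric])
  finally show ?thesis .
qed

text \<open>With t = |\<alpha>|^2, the weight of \<open>binom_state j\<close> is the one that makes
  its Wigner function \<open>t ^ j * exp (- 2 * t)\<close>. The map therefore inverts the passage
  from operators to polynomials; see \<open>wigner_poly_op\<close>.\<close>

definition poly_op :: "real poly \<Rightarrow> fmat" where
  "poly_op Q p q = of_real (\<Sum>j\<le>degree Q. coeff Q j * (pi / 2 * fact j / 2 ^ j) * Re (binom_state j p q))"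

text \<open>This is the trace of \<open>poly_op Q\<close>, and also the integral of its Wigner
  function over the plane: pi times the integral of Q(t) exp(-2 t) over t \<ge> 0.\<close>

definition poly_mass :: "real poly \<Rightarrow> real" where
  "poly_mass Q = (\<Sum>j\<le>degree Q. coeff Q j * (pi / 2 * fact j / 2 ^ j))"

lemma sum_coeff_extend:
  fixes Q :: "'a::comm_semiring_1 poly"
  assumes "degree Q \<le> n"
  shows "(\<Sum>j\<le>degree Q. coeff Q j * g j) = (\<Sum>j\<le>n. coeff Q j * g j)"
  by (rule sum.mono_neutral_left) (use assms in \<open>auto simp: coeff_eq_0\<close>)

lemma poly_op_altdef:
  assumes "degree Q \<le> n"
  shows "poly_op Q p q = of_real (\<Sum>j\<le>n. coeff Q j * (pi / 2 * fact j / 2 ^ j) * Re (binom_state j p q))"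
  unfolding poly_op_def mult.assoc sum_coeff_extend[OF assms] ..

lemma poly_mass_altdef:
  assumes "degree Q \<le> n"
  shows "poly_mass Q = (\<Sum>j\<le>n. coeff Q j * (pi / 2 * fact j / 2 ^ j))"
  unfolding poly_mass_def sum_coeff_extend[OF assms] ..

lemma poly_op_add: "poly_op (P + Q) p q = poly_op P p q + poly_op Q p q"
proof -
  define n where "n = max (degree P) (degree Q)"
  have d: "degree P \<le> n" "degree Q \<le> n" "degree (P + Q) \<le> n" by (auto simp: n_def degree_add_le_max)
  show ?thesis
    unfolding d[THEN poly_op_altdef] by (simp only: coeff_add distrib_right sum.distrib of_real_add)
qed

lemma poly_mass_add: "poly_mass (P + Q) = poly_mass P + poly_mass Q"
proof -
  define n where "n = max (degree P) (degree Q)"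
  have d: "degree P \<le> n" "degree Q \<le> n" "degree (P + Q) \<le> n" by (auto simp: n_def degree_add_le_max)
  show ?thesis
    unfolding d[THEN poly_mass_altdef] by (simp only: coeff_add distrib_right sum.distrib of_real_add)
qed

lemma poly_mass_smult: "poly_mass (smult c P) = c * poly_mass P"
  by (subst poly_mass_altdef[OF degree_smult_le]) (simp add: poly_mass_def sum_distrib_left mult.assoc)

lemma poly_mass_diff: "poly_mass (P - Q) = poly_mass P - poly_mass Q"
proof -
  have "P - Q = P + smult (- 1) Q" by simp
  then show ?thesis by (simp only: poly_mass_add poly_mass_smult)
qed

lemma poly_op_supported: "degree Q \<le> n \<Longrightarrow> supported_upto n (poly_op Q)"
  unfolding supported_upto_def by (auto simp: poly_op_altdef binom_state_def intro!: sum.neutral)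

lemma poly_op_phase_invariant: "phase_invariant (poly_op Q)"
  unfolding phase_invariant_def by (auto simp: poly_op_def binom_state_def)

lemma poly_op_hermitian: "hermitian_op (poly_op Q)"
  unfolding hermitian_op_def by (auto simp: poly_op_def binom_state_def intro!: sum.cong)

lemma poly_op_trace_class: "trace_class (poly_op Q)"
  by (rule supported_upto_trace_class[OF poly_op_supported[OF order_refl]])

lemma op_trace_poly_op: "op_trace (poly_op Q) = of_real (poly_mass Q)"
proof -
  define n where "n = degree Q"
  have "op_trace (poly_op Q) = (\<Sum>\<^sub>\<infinity>k\<in>{..n}. poly_op Q k k)"
    unfolding op_trace_def
    by (rule infsum_cong_neutral) (use poly_op_supported[of Q n] in \<open>auto simp: n_def supported_upto_def\<close>)
  also have "\<dots> = (\<Sum>k\<le>n. poly_op Q k k)" by simp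
  also have "\<dots> = of_real (\<Sum>k\<le>n. \<Sum>j\<le>n. coeff Q j * (pi / 2 * fact j / 2 ^ j) * Re (binom_state j k k))"
    by (simp add: poly_op_def n_def)
  also have "(\<Sum>k\<le>n. \<Sum>j\<le>n. coeff Q j * (pi / 2 * fact j / 2 ^ j) * Re (binom_state j k k))
     = (\<Sum>j\<le>n. \<Sum>k\<le>n. coeff Q j * (pi / 2 * fact j / 2 ^ j) * Re (binom_state j k k))"
    by (rule sum.swap)
  also have "\<dots> = poly_mass Q"
    unfolding poly_mass_def n_def[symmetric]
  proof (intro sum.cong refl)
    fix j assume j: "j \<in> {..n}"
    have "(\<Sum>k\<le>n. Re (binom_state j k k)) = (\<Sum>k\<le>j. (1/2) ^ j * real (j choose k))"
      by (rule sum.mono_neutral_cong_right) (use j in \<open>auto simp: binom_state_def\<close>)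
    also have "\<dots> = (1/2) ^ j * real (\<Sum>k\<le>j. j choose k)" by (simp add: sum_distrib_left)
    also have "\<dots> = 1" unfolding choose_row_sum by (simp add: power_divide)
    finally show "(\<Sum>k\<le>n. coeff Q j * (pi / 2 * fact j / 2 ^ j) * Re (binom_state j k k)) = coeff Q j * (pi / 2 * fact j / 2 ^ j)"
      by (simp only: sum_distrib_left[symmetric] mult_1_right)
  qed
  finally show ?thesis .
qed

text \<open>After exchanging the sums, \<open>alternating_choose_lag\<close> at \<open>4 * t\<close>
  collapses the \<open>j\<close>-th binomial state to \<open>(4 * t) ^ j / (2 ^ j * fact j)\<close>,
  and the weight in \<open>poly_op\<close> reduces this to \<open>pi / 2 * t ^ j\<close>.\<close>

lemma wigner_poly_op: "wigner (poly_op Q) \<alpha> = of_real (poly Q ((cmod \<alpha>)\<^sup>2) * exp (- 2 * (cmod \<alpha>)\<^sup>2))"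
proof -
  define n where "n = degree Q"
  define t where "t = (cmod \<alpha>)\<^sup>2"
  define b where "b j k = (if k \<le> j then (1/2) ^ j * real (j choose k) else 0)" for j k
  have "(\<Sum>k\<le>n. poly_op Q k k * of_real ((-1) ^ k * lag 0 k (4 * t)))
     = of_real (\<Sum>k\<le>n. (\<Sum>j\<le>n. coeff Q j * (pi / 2 * fact j / 2 ^ j) * b j k) * ((-1) ^ k * lag 0 k (4 * t)))"
    by (simp add: poly_op_def n_def binom_state_def b_def if_distrib cong: if_cong)
  also have "(\<Sum>k\<le>n. (\<Sum>j\<le>n. coeff Q j * (pi / 2 * fact j / 2 ^ j) * b j k) * ((-1) ^ k * lag 0 k (4 * t)))
    = (\<Sum>k\<le>n. \<Sum>j\<le>n. coeff Q j * (pi / 2 * fact j / 2 ^ j) * (b j k * ((-1) ^ k * lag 0 k (4 * t))))"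
    by (simp only: sum_distrib_right mult.assoc)
  also have "\<dots> = (\<Sum>j\<le>n. \<Sum>k\<le>n. coeff Q j * (pi / 2 * fact j / 2 ^ j) * (b j k * ((-1) ^ k * lag 0 k (4 * t))))"
    by (rule sum.swap)
  also have "\<dots> = (\<Sum>j\<le>n. coeff Q j * (pi / 2 * fact j / 2 ^ j) * ((1/2) ^ j * ((4 * t) ^ j / fact j)))"
    unfolding sum_distrib_left[symmetric]
  proof (intro sum.cong refl arg_cong2[where f = "(*)"])
    fix j assume j: "j \<in> {..n}"
    have "(\<Sum>k\<le>n. b j k * ((-1) ^ k * lag 0 k (4 * t))) = (\<Sum>k\<le>j. (1/2) ^ j * ((-1) ^ k * of_nat (j choose k) * lag 0 k (4 * t)))"
      by (rule sum.mono_neutral_cong_right) (use j in \<open>auto simp: b_def\<close>)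
    also have "\<dots> = (1/2) ^ j * ((4 * t) ^ j / fact j)"
      by (simp only: sum_distrib_left[symmetric] alternating_choose_lag)
    finally show "(\<Sum>k\<le>n. b j k * ((-1) ^ k * lag 0 k (4 * t))) = (1/2) ^ j * ((4 * t) ^ j / fact j)" .
  qed
  also have "\<dots> = (\<Sum>j\<le>n. pi / 2 * (coeff Q j * t ^ j))"
  proof (intro sum.cong refl)
    fix j
    have "4 * t = 2 * 2 * t" by simp
    then have four: "(4 * t) ^ j = 2 ^ j * 2 ^ j * t ^ j" by (simp only: power_mult_distrib)
    show "coeff Q j * (pi / 2 * fact j / 2 ^ j) * ((1/2) ^ j * ((4 * t) ^ j / fact j)) = pi / 2 * (coeff Q j * t ^ j)"
      unfolding four by (simp add: power_divide)
  qed
  also have "\<dots> = pi / 2 * poly Q t" by (simp add: poly_altdef n_def sum_distrib_left)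
  finally have s: "(\<Sum>k\<le>n. poly_op Q k k * of_real ((-1) ^ k * lag 0 k (4 * t))) = of_real (pi / 2 * poly Q t)" .
  have "wigner (poly_op Q) \<alpha> = of_real (2 / pi * exp (- 2 * t)) * (\<Sum>k\<le>n. poly_op Q k k * of_real ((-1) ^ k * lag 0 k (4 * t)))"
    unfolding t_def n_def by (rule wigner_phase_invariant[OF poly_op_supported[OF order_refl] poly_op_phase_invariant])
  then show ?thesis unfolding s t_def[symmetric] by simp
qed

text \<open>With x = 2 t the mass becomes the integral of a nonnegative function.\<close>

lemma poly_mass_nonneg:
  assumes "\<And>t. 0 \<le> t \<Longrightarrow> 0 \<le> poly Q t"
  shows "0 \<le> poly_mass Q"
proof (rule has_integral_nonneg)
  have "((\<lambda>x. \<Sum>j\<le>degree Q. coeff Q j * (pi / 2 / 2 ^ j) * (x ^ j * exp (- x))) has_integral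
      (\<Sum>j\<le>degree Q. coeff Q j * (pi / 2 / 2 ^ j) * fact j)) {0..}"
    by (intro has_integral_sum has_integral_mult_right has_integral_power_exp) auto
  also have "(\<Sum>j\<le>degree Q. coeff Q j * (pi / 2 / 2 ^ j) * fact j) = poly_mass Q"
    by (simp add: poly_mass_def mult_ac)
  also have "(\<lambda>x. \<Sum>j\<le>degree Q. coeff Q j * (pi / 2 / 2 ^ j) * (x ^ j * exp (- x))) = (\<lambda>x. pi / 2 * exp (- x) * poly Q (x / 2))"
    unfolding poly_altdef sum_distrib_left by (intro ext sum.cong refl) (simp add: power_divide)
  finally show "((\<lambda>x. pi / 2 * exp (- x) * poly Q (x / 2)) has_integral poly_mass Q) {0..}" .
qed (use assms in simp)

text \<open>\<open>Q\<close> is read off from the Laguerre expansion of the Wigner function.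
  \<open>wigner_injective\<close> then identifies the operators, in place of an inversion of the
  binomial matrix.\<close>

lemma phase_invariant_poly_op:
  assumes "hermitian_op A" "supported_upto n A" "phase_invariant A"
  obtains Q where "degree Q \<le> n" "A = poly_op Q"
proof -
  define c where "c k q = sqrt (fact (k + 0) * fact k) / (fact (k - q) * fact (0 + q) * fact q) * (-4) ^ q" for k q :: nat
  define Q where "Q = (\<Sum>k\<le>n. smult (2 / pi * Re (A k k) * (-1) ^ k) (\<Sum>q\<le>k. monom (c k q) q))"
  have deg: "degree Q \<le> n" unfolding Q_def
    by (intro degree_sum_le order_trans[OF degree_smult_le]) (auto intro!: degree_sum_le order_trans[OF degree_monom_le])
  have lag: "poly (\<Sum>q\<le>k. monom (c k q) q) t = lag 0 k (4 * t)" for k t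
    unfolding lag_def poly_sum poly_monom c_def
    by (intro sum.cong refl) (simp add: power_mult_distrib[of "-4" t, symmetric])
  have pQ: "poly Q t = 2 / pi * (\<Sum>k\<le>n. Re (A k k) * ((-1) ^ k * lag 0 k (4 * t)))" for t
    unfolding Q_def poly_sum[where A = "{..n}"] poly_smult sum_distrib_left lag by (simp only: mult.assoc)
  have Re: "A k k = of_real (Re (A k k))" for k
    using assms(1)[unfolded hermitian_op_def, rule_format, of k k] by (simp add: complex_eq_iff)
  have "wigner A \<alpha> = wigner (poly_op Q) \<alpha>" for \<alpha>
  proof -
    have "wigner A \<alpha> = of_real (2 / pi * exp (- 2 * (cmod \<alpha>)\<^sup>2)) * (\<Sum>k\<le>n. of_real (Re (A k k)) * of_real ((-1) ^ k * lag 0 k (4 * (cmod \<alpha>)\<^sup>2)))"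
      by (simp only: wigner_phase_invariant[OF assms(2,3)] Re[symmetric])
    then show ?thesis by (simp add: wigner_poly_op pQ)
  qed
  then have "A = poly_op Q"
    by (intro wigner_injective assms(1) supported_upto_trace_class[OF assms(2)] poly_op_hermitian poly_op_trace_class)
  with deg show ?thesis by (rule that)
qed

lemma A_oplus_iff:
  "A \<in> A_oplus n \<longleftrightarrow> (\<exists>Q. degree Q \<le> n \<and> A = poly_op Q \<and> poly_mass Q = 1 \<and> (\<forall>t\<ge>0. 0 \<le> poly Q t))"
proof
  assume A: "A \<in> A_oplus n"
  then have A': "hermitian_op A" "op_trace A = 1" "supported_upto n A" "phase_invariant A" "wigner_nonneg A"
    by (auto simp: A_oplus_def quasi_states_upto_def quasi_state_def)
  obtain Q where Q: "degree Q \<le> n" "A = poly_op Q" using phase_invariant_poly_op[OF A'(1,3,4)] by blast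
  have "0 \<le> poly Q t" if "t \<ge> 0" for t
  proof -
    have "0 \<le> Re (wigner A (of_real (sqrt t)))" using A'(5) by (simp add: wigner_nonneg_def)
    then have "0 \<le> poly Q t * exp (- 2 * t)" unfolding Q wigner_poly_op Re_complex_of_real using that by simp
    then show ?thesis by (simp add: zero_le_mult_iff)
  qed
  then show "\<exists>Q. degree Q \<le> n \<and> A = poly_op Q \<and> poly_mass Q = 1 \<and> (\<forall>t\<ge>0. 0 \<le> poly Q t)"
    using Q A'(2) by (intro exI[of _ Q]) (auto simp: op_trace_poly_op)
next
  assume "\<exists>Q. degree Q \<le> n \<and> A = poly_op Q \<and> poly_mass Q = 1 \<and> (\<forall>t\<ge>0. 0 \<le> poly Q t)"
  then obtain Q where Q: "degree Q \<le> n" "A = poly_op Q" "poly_mass Q = 1" "\<forall>t\<ge>0. 0 \<le> poly Q t" by blast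
  have "wigner_nonneg A"
    unfolding wigner_nonneg_def Q(2) wigner_poly_op Im_complex_of_real Re_complex_of_real using Q(4) by simp
  moreover have "quasi_state A"
    unfolding quasi_state_def Q(2) op_trace_poly_op Q(3) using poly_op_hermitian poly_op_trace_class by simp
  ultimately show "A \<in> A_oplus n"
    unfolding A_oplus_def quasi_states_upto_def using Q(1,2) poly_op_phase_invariant poly_op_supported by simp
qed

lemma poly_eq_on_nonneg:
  fixes p q :: "real poly"
  assumes "\<And>t. 0 \<le> t \<Longrightarrow> poly p t = poly q t"
  shows "p = q"
proof (rule ccontr)
  assume "p \<noteq> q"
  then have "finite {t. poly (p - q) t = 0}" by (intro poly_roots_finite) simp
  moreover have "{0..} \<subseteq> {t. poly (p - q) t = 0}" using assms by auto
  ultimately have "finite {0::real..}" by (rule finite_subset[rotated])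
  then show False by (simp add: infinite_Ici)
qed

lemma poly_op_eq_iff: "poly_op P = poly_op Q \<longleftrightarrow> P = Q"
proof
  assume eq: "poly_op P = poly_op Q"
  show "P = Q"
  proof (rule poly_eq_on_nonneg)
    fix t :: real assume t: "0 \<le> t"
    have "poly P ((cmod (of_real (sqrt t)))\<^sup>2) * exp (- 2 * (cmod (of_real (sqrt t)))\<^sup>2) =
      poly Q ((cmod (of_real (sqrt t)))\<^sup>2) * exp (- 2 * (cmod (of_real (sqrt t)))\<^sup>2)"
      using wigner_poly_op[of P "of_real (sqrt t)"] wigner_poly_op[of Q "of_real (sqrt t)"] eq
      by (simp only: of_real_eq_iff)
    then show "poly P t = poly Q t" using t by simp
  qed
qed simp

section \<open>Polynomials nonnegative on the half-line\<close>

lemma poly_nonneg_at_limit: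
  fixes p :: "real poly"
  assumes "\<forall>\<^sub>F t in at a within S. 0 \<le> poly p t" "at a within S \<noteq> bot"
  shows "0 \<le> poly p a"
proof (rule tendsto_lowerbound)
  show "(poly p \<longlongrightarrow> poly p a) (at a within S)"
    by (intro tendsto_intros)
qed (use assms in auto)

lemma poly_nonneg_right:
  fixes p :: "real poly"
  assumes "\<And>t. a < t \<Longrightarrow> 0 \<le> poly p t"
  shows "0 \<le> poly p a"
  by (rule poly_nonneg_at_limit[where S = "{a<..}"]) (use assms in \<open>auto simp: eventually_at_right_less intro: eventually_at_rightI[of a "a+1"]\<close>)

text \<open>Division by t preserves the sign for t > 0, and continuity settles t = 0. At this
  boundary point a root may be simple, unlike the interior roots below.\<close>

lemma nonneg_poly_root_0:
  fixes X :: "real poly"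
  assumes X: "\<And>t. 0 \<le> t \<Longrightarrow> 0 \<le> poly X t" and "poly X 0 = 0"
  obtains S where "X = [:0, 1:] * S" "\<And>t. 0 \<le> t \<Longrightarrow> 0 \<le> poly S t"
proof -
  obtain S where S: "X = [:0, 1:] * S" using assms(2) by (metis dvdE minus_zero poly_eq_0_iff_dvd)
  have pos: "0 \<le> poly S t" if "0 < t" for t
    using X[of t] that by (simp add: S zero_le_mult_iff)
  then have "0 \<le> poly S 0" by (rule poly_nonneg_right)
  with pos show ?thesis using that[OF S] by (metis order_le_less)
qed

text \<open>The quotient by t - a is nonnegative to the right of a and nonpositive between 0 and a,
  so it vanishes at a and a second factor splits off.\<close>

lemma nonneg_poly_double_root:
  fixes X :: "real poly"
  assumes X: "\<And>t. 0 \<le> t \<Longrightarrow> 0 \<le> poly X t" and "0 < a" "poly X a = 0"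
  obtains S where "X = [:- a, 1:]\<^sup>2 * S" "\<And>t. 0 \<le> t \<Longrightarrow> 0 \<le> poly S t"
proof -
  obtain Q where Q: "X = [:- a, 1:] * Q" using assms(3) by (metis dvdE poly_eq_0_iff_dvd)
  have Qt: "poly X t = (t - a) * poly Q t" for t by (simp add: Q algebra_simps)
  have r: "0 \<le> poly Q t" if "a < t" for t
    using X[of t] that \<open>0 < a\<close> unfolding Qt by (simp add: zero_le_mult_iff)
  have l: "0 \<le> poly (- Q) t" if "0 < t" "t < a" for t
    using X[of t] that unfolding Qt by (simp add: zero_le_mult_iff)
  have "0 \<le> poly Q a" using r by (rule poly_nonneg_right)
  moreover have "0 \<le> poly (- Q) a"
    by (rule poly_nonneg_at_limit[where S = "{..<a}"]) (use l \<open>0 < a\<close> in \<open>auto intro: eventually_at_leftI[of 0 a]\<close>)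
  ultimately have "poly Q a = 0" by simp
  then obtain S where S: "Q = [:- a, 1:] * S" by (metis dvdE poly_eq_0_iff_dvd)
  have X': "X = [:- a, 1:]\<^sup>2 * S" unfolding Q S power2_eq_square by (rule mult.assoc[symmetric])
  have Xt: "poly X t = (t - a)\<^sup>2 * poly S t" for t by (simp add: X' poly_power)
  have ne: "0 \<le> poly S t" if "0 \<le> t" "t \<noteq> a" for t
  proof -
    have "0 < (t - a)\<^sup>2" using that(2) by simp
    then show ?thesis using X[OF that(1)] unfolding Xt by (simp only: zero_le_mult_iff) linarith
  qed
  have "0 \<le> poly S a" by (rule poly_nonneg_right, rule ne) (use \<open>0 < a\<close> in auto)
  then have "0 \<le> poly S t" if "0 \<le> t" for t using ne[OF that] by (cases "t = a") auto
  then show ?thesis by (rule that[OF X'])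
qed

definition square_poly :: "nat \<Rightarrow> nat \<Rightarrow> (nat \<Rightarrow> real) \<Rightarrow> real poly" where
  "square_poly k l lam = [:0, 1:] ^ k * (\<Prod>i<l. [:- lam i, 1:]\<^sup>2)"

lemma poly_square_poly: "poly (square_poly k l lam) t = t ^ k * (\<Prod>i<l. (t - lam i)\<^sup>2)"
  by (simp add: square_poly_def poly_power poly_prod)

lemma square_poly_nonneg: "0 \<le> t \<Longrightarrow> 0 \<le> poly (square_poly k l lam) t"
  by (simp add: poly_square_poly prod_nonneg)

lemma square_poly_Suc_power: "square_poly (Suc k) l lam = [:0, 1:] * square_poly k l lam"
  unfolding square_poly_def power_Suc mult.assoc ..

lemma square_poly_Suc_roots: "square_poly k (Suc l) lam = [:- lam l, 1:]\<^sup>2 * square_poly k l lam"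
  unfolding square_poly_def prod.lessThan_Suc by (simp only: mult_ac)

lemma square_poly_cong: "(\<And>i. i < l \<Longrightarrow> lam i = lam' i) \<Longrightarrow> square_poly k l lam = square_poly k l lam'"
  by (simp add: square_poly_def)

lemma square_poly_nz: "square_poly k l lam \<noteq> 0"
  by (auto simp: square_poly_def prod_zero_iff)

lemma degree_square_poly: "degree (square_poly k l lam) = k + 2 * l"
proof (induction l)
  case 0
  show ?case by (simp add: square_poly_def degree_power_eq)
next
  case (Suc l)
  have "degree (square_poly k (Suc l) lam) = degree ([:- lam l, 1:]\<^sup>2) + degree (square_poly k l lam)"
    unfolding square_poly_Suc_roots by (rule degree_mult_eq) (auto simp: square_poly_nz)
  then show ?case using Suc by (simp add: degree_power_eq)
qed

text \<open>Induction on the degree: \<open>nonneg_poly_root_0\<close> or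
  \<open>nonneg_poly_double_root\<close> divides out one root on the half-line at a time, until none
  is left.\<close>

lemma nonneg_poly_factor:
  fixes P :: "real poly"
  assumes "P \<noteq> 0" "\<And>t. 0 \<le> t \<Longrightarrow> 0 \<le> poly P t"
  shows "\<exists>k l lam R. (\<forall>i<l. 0 < lam i) \<and> P = square_poly k l lam * R \<and> (\<forall>t\<ge>0. 0 < poly R t)"
  using assms
proof (induction "degree P" arbitrary: P rule: less_induct)
  case less
  show ?case
  proof (cases "\<exists>t\<ge>0. poly P t = 0")
    case False
    then have "\<forall>t\<ge>0. 0 < poly P t" using less.prems(2) by (metis order_le_less)
    then show ?thesis by (intro exI[of _ 0] exI[of _ "\<lambda>_. 0"] exI[of _ P]) (simp add: square_poly_def)
  next
    case True
    then obtain a where a: "0 \<le> a" "poly P a = 0" by blast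
    show ?thesis
    proof (cases "a = 0")
      case True
      obtain S where S: "P = [:0, 1:] * S" "\<And>t. 0 \<le> t \<Longrightarrow> 0 \<le> poly S t"
        by (rule nonneg_poly_root_0[of P]) (use less.prems(2) a True in auto)
      have "S \<noteq> 0" using S(1) less.prems(1) by auto
      then have "degree S < degree P" unfolding S(1) by (subst degree_mult_eq) auto
      from less.hyps[OF this \<open>S \<noteq> 0\<close> S(2)] obtain k l lam R
        where *: "\<forall>i<l. 0 < lam i" "S = square_poly k l lam * R" "\<forall>t\<ge>0. 0 < poly R t" by blast
      show ?thesis
        by (intro exI[of _ "Suc k"] exI[of _ l] exI[of _ lam] exI[of _ R])
          (use * in \<open>auto simp only: S(1) square_poly_Suc_power mult.assoc\<close>)
    next
      case False
      with a have "0 < a" by simp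
      obtain S where S: "P = [:- a, 1:]\<^sup>2 * S" "\<And>t. 0 \<le> t \<Longrightarrow> 0 \<le> poly S t"
        by (rule nonneg_poly_double_root[of P a]) (use less.prems(2) a \<open>0 < a\<close> in auto)
      have "S \<noteq> 0" using S(1) less.prems(1) by auto
      then have "degree S < degree P" unfolding S(1) by (subst degree_mult_eq) (auto simp: degree_power_eq)
      from less.hyps[OF this \<open>S \<noteq> 0\<close> S(2)] obtain k l lam R
        where *: "\<forall>i<l. 0 < lam i" "S = square_poly k l lam * R" "\<forall>t\<ge>0. 0 < poly R t" by blast
      \<comment> \<open>The new root is put into slot \<open>l\<close>, beyond the indices used by
        the induction hypothesis.\<close>
      define lam' where "lam' = lam(l := a)"
      have "square_poly k l lam' = square_poly k l lam" by (rule square_poly_cong) (simp add: lam'_def)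
      then have "square_poly k (Suc l) lam' = [:- a, 1:]\<^sup>2 * square_poly k l lam"
        by (simp add: square_poly_Suc_roots lam'_def)
      then have "P = square_poly k (Suc l) lam' * R" by (simp only: S(1) *(2) mult.assoc)
      moreover have "\<forall>i<Suc l. 0 < lam' i" using *(1) \<open>0 < a\<close> by (auto simp: lam'_def less_Suc_eq)
      ultimately show ?thesis using *(3) by blast
    qed
  qed
qed

lemma poly_bounded_imp_degree_0:
  fixes X :: "real poly"
  assumes "\<And>t. 0 \<le> t \<Longrightarrow> \<bar>poly X t\<bar> \<le> K"
  shows "degree X = 0"
proof (rule ccontr)
  assume "degree X \<noteq> 0"
  then have "filterlim (poly X) at_infinity at_infinity" by (intro filterlim_poly_at_infinity) auto
  then have "filterlim (poly X) at_infinity at_top" by (rule filterlim_mono) (auto simp: at_top_le_at_infinity)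
  then have "\<forall>\<^sub>F t in at_top. \<bar>K\<bar> + 1 \<le> norm (poly X t)"
    unfolding filterlim_at_infinity[OF order_refl] by (elim allE[of _ "\<bar>K\<bar> + 1"]) simp
  then have "\<forall>\<^sub>F t in at_top. \<bar>K\<bar> + 1 \<le> norm (poly X t) \<and> 0 \<le> t"
    using eventually_ge_at_top by (rule eventually_conj)
  then obtain t where "\<bar>K\<bar> + 1 \<le> norm (poly X t)" "0 \<le> t"
    by (metis (mono_tags, lifting) eventually_happens' trivial_limit_at_top_linorder)
  then show False using assms[of t] by simp
qed

text \<open>\<open>X\<close> and its complement \<open>D\<close> are nonnegative and add up to
  \<open>K\<close> times the product, so both vanish at each of its roots. Both can be divided by
  the corresponding factor, and the quotients add up to \<open>K\<close> times the shorter product.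
  When no factor is left, \<open>X\<close> is bounded on the half-line, hence constant.\<close>

lemma dominated_by_square_poly:
  fixes X :: "real poly"
  assumes "\<forall>i<l. 0 < lam i" "\<And>t. 0 \<le> t \<Longrightarrow> 0 \<le> poly X t"
    "\<And>t. 0 \<le> t \<Longrightarrow> poly X t \<le> K * poly (square_poly k l lam) t"
  shows "\<exists>c. X = smult c (square_poly k l lam)"
  using assms
proof (induction l arbitrary: X)
  case 0
  from 0(2,3) show ?case
  proof (induction k arbitrary: X)
    case 0
    have "degree X = 0"
      by (rule poly_bounded_imp_degree_0[of X K]) (use 0 in \<open>fastforce simp: square_poly_def\<close>)
    then obtain c where "X = [:c:]" by (rule degree_eq_zeroE)
    then show ?case by (intro exI[of _ c]) (simp add: square_poly_def)
  next
    case (Suc k)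
    define D where "D = smult K (square_poly (Suc k) 0 lam) - X"
    have D: "0 \<le> poly D t" if "0 \<le> t" for t using Suc.prems(2)[OF that] by (simp add: D_def)
    have z: "poly (square_poly (Suc k) 0 lam) 0 = 0" by (simp add: poly_square_poly)
    then have X0: "poly X 0 = 0" using Suc.prems(1,2)[of 0] by simp
    then have D0: "poly D 0 = 0" using z by (simp add: D_def)
    obtain S where S: "X = [:0, 1:] * S" "\<And>t. 0 \<le> t \<Longrightarrow> 0 \<le> poly S t"
      by (rule nonneg_poly_root_0[of X]) (use Suc.prems X0 in blast)+
    obtain T where T: "D = [:0, 1:] * T" "\<And>t. 0 \<le> t \<Longrightarrow> 0 \<le> poly T t"
      by (rule nonneg_poly_root_0[of D]) (use D D0 in blast)+
    have "[:0, 1:] * (S + T) = [:0, 1:] * smult K (square_poly k 0 lam)"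
      unfolding distrib_left S(1)[symmetric] T(1)[symmetric] mult_smult_right square_poly_Suc_power[symmetric]
      by (simp add: D_def)
    then have ST: "S + T = smult K (square_poly k 0 lam)" by (simp only: mult_cancel_left) simp
    have "poly S t \<le> K * poly (square_poly k 0 lam) t" if "0 \<le> t" for t
      using T(2)[OF that] arg_cong[OF ST, of "\<lambda>p. poly p t"] by simp
    then obtain c where "S = smult c (square_poly k 0 lam)" using Suc.IH[OF S(2)] by blast
    then show ?case by (intro exI[of _ c]) (simp only: S(1) square_poly_Suc_power mult_smult_right)
  qed
next
  case (Suc l)
  define D where "D = smult K (square_poly k (Suc l) lam) - X"
  have lam: "0 < lam l" using Suc.prems(1) by simp
  have D: "0 \<le> poly D t" if "0 \<le> t" for t using Suc.prems(3)[OF that] by (simp add: D_def)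
  have z: "poly (square_poly k (Suc l) lam) (lam l) = 0" by (simp add: poly_square_poly)
  then have X0: "poly X (lam l) = 0" using Suc.prems(2,3)[of "lam l"] lam by simp
  then have D0: "poly D (lam l) = 0" using z by (simp add: D_def)
  obtain S where S: "X = [:- lam l, 1:]\<^sup>2 * S" "\<And>t. 0 \<le> t \<Longrightarrow> 0 \<le> poly S t"
    by (rule nonneg_poly_double_root[of X]) (use Suc.prems X0 lam in blast)+
  obtain T where T: "D = [:- lam l, 1:]\<^sup>2 * T" "\<And>t. 0 \<le> t \<Longrightarrow> 0 \<le> poly T t"
    by (rule nonneg_poly_double_root[of D]) (use D D0 lam in blast)+
  have "[:- lam l, 1:]\<^sup>2 * (S + T) = [:- lam l, 1:]\<^sup>2 * smult K (square_poly k l lam)"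
    unfolding distrib_left S(1)[symmetric] T(1)[symmetric] mult_smult_right square_poly_Suc_roots[symmetric]
    by (simp add: D_def)
  then have ST: "S + T = smult K (square_poly k l lam)" by (simp only: mult_cancel_left) simp
  have "poly S t \<le> K * poly (square_poly k l lam) t" if "0 \<le> t" for t
    using T(2)[OF that] arg_cong[OF ST, of "\<lambda>p. poly p t"] by simp
  then obtain c where "S = smult c (square_poly k l lam)"
    using Suc.IH[OF _ S(2)] Suc.prems(1) by auto
  then show ?case by (intro exI[of _ c]) (simp only: S(1) square_poly_Suc_roots mult_smult_right)
qed

text \<open>A nonconstant polynomial has absolute value at least 1 beyond some \<open>B\<close>; on
  the remaining compact interval the minimum is attained and positive.\<close>

lemma positive_poly_bounded_below:
  fixes R :: "real poly"
  assumes R: "\<And>t. 0 \<le> t \<Longrightarrow> 0 < poly R t" and deg: "degree R \<noteq> 0"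
  obtains \<delta> where "0 < \<delta>" "\<And>t. 0 \<le> t \<Longrightarrow> \<delta> \<le> poly R t"
proof -
  have "filterlim (poly R) at_infinity at_infinity" using deg by (intro filterlim_poly_at_infinity) auto
  then have "filterlim (poly R) at_infinity at_top" by (rule filterlim_mono) (auto simp: at_top_le_at_infinity)
  then have "\<forall>\<^sub>F t in at_top. 1 \<le> norm (poly R t)"
    unfolding filterlim_at_infinity[OF order_refl] by (elim allE[of _ 1]) simp
  then obtain B where B: "\<And>t. B \<le> t \<Longrightarrow> 1 \<le> \<bar>poly R t\<bar>"
    unfolding eventually_at_top_linorder by auto
  have "continuous_on {0..max 0 B} (poly R)" by (intro continuous_intros)
  then obtain s where s: "s \<in> {0..max 0 B}" "\<And>t. t \<in> {0..max 0 B} \<Longrightarrow> poly R s \<le> poly R t"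
    using continuous_attains_inf[of "{0..max 0 B}" "poly R"] by fastforce
  show ?thesis
  proof (rule that)
    show "0 < min 1 (poly R s)" using R s(1) by simp
    show "min 1 (poly R s) \<le> poly R t" if "0 \<le> t" for t
      using s(2)[of t] B[of t] R[OF that] that by (cases "t \<le> B") (auto simp: min_le_iff_disj)
  qed
qed

section \<open>Extreme points\<close>

lemma extreme_imp_square_poly:
  assumes "poly_op P \<in> extreme_points (A_oplus n)" "degree P \<le> n"
  obtains c k l lam where "0 < c" "k + 2 * l \<le> n" "\<forall>i<l. 0 < lam i" "P = smult c (square_poly k l lam)"
proof -
  have ext: "X = P \<and> Y = P"
    if "degree X \<le> n" "poly_mass X = 1" "\<forall>t\<ge>0. 0 \<le> poly X t"
       "degree Y \<le> n" "poly_mass Y = 1" "\<forall>t\<ge>0. 0 \<le> poly Y t" "X + Y = P + P" for X Y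
  proof -
    have "poly_op X \<in> A_oplus n" "poly_op Y \<in> A_oplus n" using that by (auto simp: A_oplus_iff)
    moreover have "poly_op X k l + poly_op Y k l = poly_op P k l + poly_op P k l" for k l
      by (simp only: poly_op_add[symmetric] \<open>X + Y = P + P\<close>)
    then have "poly_op P k l = (poly_op X k l + poly_op Y k l) / 2" for k l by simp
    ultimately have "poly_op X = poly_op P \<and> poly_op Y = poly_op P"
      using assms(1) unfolding extreme_points_def by blast
    then show ?thesis by (simp add: poly_op_eq_iff)
  qed
  obtain Q where "poly_op P = poly_op Q" "poly_mass Q = 1" "\<forall>t\<ge>0. 0 \<le> poly Q t"
    using assms(1) unfolding extreme_points_def by (auto simp: A_oplus_iff)
  then have P: "poly_mass P = 1" "\<And>t. 0 \<le> t \<Longrightarrow> 0 \<le> poly P t" by (auto simp: poly_op_eq_iff)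
  have "P \<noteq> 0" using P(1) by (auto simp: poly_mass_def)
  then obtain k l lam R where lam: "\<forall>i<l. 0 < lam i" and PR: "P = square_poly k l lam * R" and R: "\<forall>t\<ge>0. 0 < poly R t"
    using nonneg_poly_factor[of P] P(2) by blast
  define F where "F = square_poly k l lam"
  have F0: "F \<noteq> 0" by (simp add: F_def square_poly_nz)
  have "R \<noteq> 0" using \<open>P \<noteq> 0\<close> PR by auto
  have degP: "degree P = k + 2 * l + degree R"
    unfolding PR by (subst degree_mult_eq) (auto simp: square_poly_nz \<open>R \<noteq> 0\<close> degree_square_poly)
  have "degree R = 0"
  proof (rule ccontr)
    assume deg: "degree R \<noteq> 0"
    obtain \<delta> where \<delta>: "0 < \<delta>" "\<And>t. 0 \<le> t \<Longrightarrow> \<delta> \<le> poly R t"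
      by (rule positive_poly_bounded_below[of R]) (use R deg in auto)
    \<comment> \<open>As \<open>R\<close> is not constant, these two nonnegative summands of
      \<open>P\<close> are linearly independent.\<close>
    define P1 where "P1 = smult \<delta> F"
    define P2 where "P2 = F * (R - [:\<delta>:])"
    have sum: "P = P1 + P2" by (simp add: P1_def P2_def PR F_def algebra_simps)
    have P1: "0 \<le> poly P1 t" if "0 \<le> t" for t
      using \<delta>(1) square_poly_nonneg[OF that] by (simp add: P1_def F_def)
    have P2: "0 \<le> poly P2 t" if "0 \<le> t" for t
      using \<delta>(2)[OF that] square_poly_nonneg[OF that] by (simp add: P2_def F_def)
    define m1 where "m1 = poly_mass P1"
    define m2 where "m2 = poly_mass P2"
    have m: "0 \<le> m1" "0 \<le> m2" "m1 + m2 = 1"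
      using poly_mass_nonneg[of P1] poly_mass_nonneg[of P2] P1 P2 P(1) by (auto simp: m1_def m2_def sum poly_mass_add)
    \<comment> \<open>\<open>S\<close> shifts mass from one summand to the other, so its own mass is
      0. \<open>P + S\<close> and \<open>P - S\<close> stay nonnegative because \<open>m1\<close>
      and \<open>m2\<close> lie between 0 and 1. This avoids normalising \<open>P1\<close> and
      \<open>P2\<close> by masses that would first have to be shown nonzero.\<close>
    define S where "S = smult m2 P1 - smult m1 P2"
    have degF: "degree F = k + 2 * l" by (simp add: F_def degree_square_poly)
    have "degree P1 \<le> degree P" unfolding P1_def using degF degP by (simp add: \<delta>(1))
    moreover from this have "degree P2 \<le> degree P"
      using degree_diff_le[of P "degree P" P1] by (simp add: sum)
    ultimately have dS: "degree S \<le> n"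
      unfolding S_def using assms(2) by (intro degree_diff_le order_trans[OF degree_smult_le]) auto
    have mS: "poly_mass S = 0" by (simp add: S_def poly_mass_diff poly_mass_smult m1_def m2_def)
    have S1: "0 \<le> poly (P + S) t" if "0 \<le> t" for t
    proof -
      have "poly (P + S) t = (1 + m2) * poly P1 t + (1 - m1) * poly P2 t" by (simp add: sum S_def algebra_simps)
      also have "0 \<le> \<dots>" using m P1[OF that] P2[OF that] by simp
      finally show ?thesis .
    qed
    have S2: "0 \<le> poly (P - S) t" if "0 \<le> t" for t
    proof -
      have "poly (P - S) t = (1 - m2) * poly P1 t + (1 + m1) * poly P2 t" by (simp add: sum S_def algebra_simps)
      also have "0 \<le> \<dots>" using m P1[OF that] P2[OF that] by simp
      finally show ?thesis .
    qed
    have "P + S = P \<and> P - S = P"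
      by (rule ext) (use S1 S2 dS mS assms(2) P(1) in \<open>auto simp: poly_mass_add poly_mass_diff degree_add_le degree_diff_le\<close>)
    then have "S = 0" by simp
    moreover have "S = F * (smult m2 [:\<delta>:] - smult m1 (R - [:\<delta>:]))"
      by (simp add: S_def P1_def P2_def algebra_simps)
    ultimately have "smult m2 [:\<delta>:] - smult m1 (R - [:\<delta>:]) = 0" using F0 by simp
    then have "smult m1 (R - [:\<delta>:]) = smult m2 [:\<delta>:]" by (simp only: right_minus_eq)
    moreover have "smult m1 R = smult m1 (R - [:\<delta>:]) + smult m1 [:\<delta>:]" by (simp add: smult_diff_right)
    \<comment> \<open>\<open>S = 0\<close> makes a multiple of \<open>R\<close> equal to a nonzero
      constant, so \<open>R\<close> itself would be constant.\<close>
    ultimately have eq: "smult m1 R = [:\<delta> * (m1 + m2):]" by (simp add: algebra_simps)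
    then have "smult m1 R \<noteq> 0" using m(3) \<delta>(1) by simp
    then have "m1 \<noteq> 0" by auto
    then have "degree R = degree (smult m1 R)" by simp
    also have "\<dots> = 0" unfolding eq by simp
    finally show False using deg by simp
  qed
  then obtain c where c: "R = [:c:]" by (rule degree_eq_zeroE)
  show ?thesis
  proof (rule that)
    show "0 < c" using R c by auto
    show "k + 2 * l \<le> n" using degP assms(2) by simp
    show "\<forall>i<l. 0 < lam i" by (rule lam)
    show "P = smult c (square_poly k l lam)" by (simp add: PR c)
  qed
qed

lemma square_poly_imp_extreme:
  assumes "0 < c" "k + 2 * l \<le> n" "\<forall>i<l. 0 < lam i"
    and P: "P = smult c (square_poly k l lam)" and mass: "poly_mass P = 1"
  shows "poly_op P \<in> extreme_points (A_oplus n)"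
proof -
  have "degree P \<le> n" using assms(1,2) by (simp add: P degree_square_poly)
  moreover have "0 \<le> poly P t" if "0 \<le> t" for t
    using square_poly_nonneg[OF that] assms(1) by (simp add: P)
  ultimately have "poly_op P \<in> A_oplus n" using mass by (auto simp: A_oplus_iff)
  moreover have main: "X = poly_op P"
    if "X \<in> A_oplus n" "Y \<in> A_oplus n" "\<And>k l. poly_op P k l = (X k l + Y k l) / 2" for X Y
  proof -
    obtain Q where Q: "X = poly_op Q" "poly_mass Q = 1" "\<forall>t\<ge>0. 0 \<le> poly Q t"
      using \<open>X \<in> A_oplus n\<close> by (auto simp: A_oplus_iff)
    obtain T where T: "Y = poly_op T" "poly_mass T = 1" "\<forall>t\<ge>0. 0 \<le> poly T t"
      using \<open>Y \<in> A_oplus n\<close> by (auto simp: A_oplus_iff)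
    have "poly_op (P + P) = poly_op (Q + T)"
      by (intro ext) (simp only: poly_op_add that(3) Q(1) T(1), simp)
    then have eq: "P + P = Q + T" by (simp only: poly_op_eq_iff)
    \<comment> \<open>Since \<open>T\<close> is nonnegative, \<open>Q\<close> is at most twice
      \<open>P\<close>.\<close>
    have "poly Q t \<le> (2 * c) * poly (square_poly k l lam) t" if "0 \<le> t" for t
      using arg_cong[OF eq, of "\<lambda>p. poly p t"] T(3)[rule_format, OF that] by (simp add: P)
    then obtain c' where c': "Q = smult c' (square_poly k l lam)"
      using dominated_by_square_poly[OF assms(3), of Q] Q(3) by blast
    \<comment> \<open>\<open>Q\<close> and \<open>P\<close> both have mass 1, which fixes the
      scalar.\<close>
    have "c * poly_mass (square_poly k l lam) = c' * poly_mass (square_poly k l lam)"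
      using Q(2) mass by (simp add: c' P poly_mass_smult)
    moreover have "poly_mass (square_poly k l lam) \<noteq> 0" using mass by (auto simp: P poly_mass_smult)
    ultimately have "c' = c" by simp
    then show ?thesis by (simp add: Q(1) c' P)
  qed
  moreover have "Y = poly_op P"
    if "X \<in> A_oplus n" "Y \<in> A_oplus n" "\<And>k l. poly_op P k l = (X k l + Y k l) / 2" for X Y
    by (rule main[OF that(2,1)]) (simp add: that(3) add.commute)
  ultimately show ?thesis unfolding extreme_points_def by blast
qed

section \<open>Elementary symmetric polynomials and binomial mixtures\<close>

lemma prod_diff_esym:
  "(\<Prod>i<m. x - \<mu> i) = (\<Sum>j\<le>m. (-1) ^ (m - j) * esym m \<mu> (m - j) * x ^ j)"
proof -
  have "(\<Prod>i<m. x - \<mu> i) = (\<Prod>i<m. - \<mu> i + x)" by simp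
  \<comment> \<open>\<open>S\<close> records the factors that contribute \<open>- \<mu> i\<close>;
    grouping the subsets by size then gives the elementary symmetric polynomials.\<close>
  also have "\<dots> = (\<Sum>S\<in>Pow {..<m}. (\<Prod>i\<in>S. - \<mu> i) * (\<Prod>i\<in>{..<m} - S. x))"
    by (rule prod_add) simp
  also have "\<dots> = (\<Sum>S\<in>Pow {..<m}. (-1) ^ card S * (\<Prod>i\<in>S. \<mu> i) * x ^ (m - card S))"
  proof (intro sum.cong refl)
    fix S assume "S \<in> Pow {..<m}"
    then have S: "S \<subseteq> {..<m}" "finite S" by (auto intro: finite_subset)
    have "(\<Prod>i\<in>S. - \<mu> i) = (\<Prod>i\<in>S. - 1 * \<mu> i)" by simp
    also have "\<dots> = (-1) ^ card S * (\<Prod>i\<in>S. \<mu> i)" by (simp only: prod.distrib prod_constant)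
    finally show "(\<Prod>i\<in>S. - \<mu> i) * (\<Prod>i\<in>{..<m} - S. x) = (-1) ^ card S * (\<Prod>i\<in>S. \<mu> i) * x ^ (m - card S)"
      using S by (simp add: card_Diff_subset)
  qed
  also have "\<dots> = (\<Sum>j\<le>m. \<Sum>S\<in>{S \<in> Pow {..<m}. card S = j}. (-1) ^ card S * (\<Prod>i\<in>S. \<mu> i) * x ^ (m - card S))"
  proof (rule sum.group[symmetric])
    show "card ` Pow {..<m} \<subseteq> {..m}"
      using card_mono[of "{..<m}"] by force
  qed auto
  also have "\<dots> = (\<Sum>j\<le>m. (-1) ^ j * esym m \<mu> j * x ^ (m - j))"
    unfolding esym_def sum_distrib_left sum_distrib_right by (intro sum.cong) auto
  also have "\<dots> = (\<Sum>j\<le>m. (-1) ^ (m - j) * esym m \<mu> (m - j) * x ^ j)"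
    by (rule sum.reindex_bij_witness[of _ "\<lambda>j. m - j" "\<lambda>j. m - j"]) auto
  finally show ?thesis .
qed

lemma prod_paired_roots:
  fixes lam \<mu> :: "nat \<Rightarrow> real"
  assumes "\<forall>i<k. \<mu> i = 0" "\<forall>i<l. \<mu> (k + 2 * i) = lam i \<and> \<mu> (k + 2 * i + 1) = lam i"
  shows "(\<Prod>i<k + 2 * l. x - \<mu> i) = x ^ k * (\<Prod>i<l. (x - lam i)\<^sup>2)"
  using assms(2)
proof (induction l)
  case 0
  then show ?case using assms(1) by simp
next
  case (Suc l)
  have "(\<Prod>i<k + 2 * Suc l. x - \<mu> i) = (\<Prod>i<k + 2 * l. x - \<mu> i) * (x - \<mu> (k + 2 * l)) * (x - \<mu> (k + 2 * l + 1))"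
    by simp
  then show ?case using Suc by (simp add: power2_eq_square mult.assoc)
qed

text \<open>The monomial \<open>t\<^sup>j\<close> corresponds to \<open>(\<pi>/2) (j! / 2\<^sup>j) \<sigma>(j,0)\<close>, whose factor \<open>2\<^sup>-\<^sup>j\<close> is absent from (iii):
  the entries of \<open>\<mu>\<close> are therefore twice the roots in (ii).\<close>
lemma poly_op_binomial_mixture:
  fixes lam \<mu> :: "nat \<Rightarrow> real"
  assumes \<mu>: "\<forall>i<k. \<mu> i = 0" "\<forall>i<l. \<mu> (k + 2 * i) = lam i \<and> \<mu> (k + 2 * i + 1) = lam i"
    and m: "k + 2 * l = m"
  shows "poly_op (smult (2 / pi * 2 ^ m * c) (square_poly k l (\<lambda>i. lam i / 2))) p q
    = of_real (c * (-1) ^ m * (\<Sum>j\<le>m. (-1) ^ j * fact j * esym m \<mu> (m - j) * Re (binom_state j p q)))"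
proof -
  define b where "b j = 2 / pi * c * 2 ^ j * (-1) ^ (m - j) * esym m \<mu> (m - j)" for j
  define Q where "Q = (\<Sum>j\<le>m. monom (b j) j)"
  have "smult (2 / pi * 2 ^ m * c) (square_poly k l (\<lambda>i. lam i / 2)) = Q"
  proof (rule poly_eq_on_nonneg)
    fix t :: real
    \<comment> \<open>\<open>prod_diff_esym\<close> is used at \<open>2 * t\<close>, which halves
      the roots; the extracted powers \<open>2 ^ k\<close> and \<open>2 ^ (2 * l)\<close> make up
      the factor \<open>2 ^ m\<close>.\<close>
    have "poly Q t = 2 / pi * c * (\<Sum>j\<le>m. (-1) ^ (m - j) * esym m \<mu> (m - j) * (2 * t) ^ j)"
      unfolding Q_def poly_sum poly_monom b_def sum_distrib_left
      by (intro sum.cong refl) (simp add: power_mult_distrib)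
    also have "(\<Sum>j\<le>m. (-1) ^ (m - j) * esym m \<mu> (m - j) * (2 * t) ^ j) = (2 * t) ^ k * (\<Prod>i<l. (2 * t - lam i)\<^sup>2)"
      unfolding prod_diff_esym[symmetric] m[symmetric] by (rule prod_paired_roots[OF \<mu>])
    also have "(\<Prod>i<l. (2 * t - lam i)\<^sup>2) = (\<Prod>i<l. 2\<^sup>2 * (t - lam i / 2)\<^sup>2)"
      by (intro prod.cong refl) (simp add: power2_eq_square algebra_simps)
    also have "\<dots> = 2 ^ (2 * l) * (\<Prod>i<l. (t - lam i / 2)\<^sup>2)"
      by (simp add: prod.distrib power_mult)
    finally show "poly (smult (2 / pi * 2 ^ m * c) (square_poly k l (\<lambda>i. lam i / 2))) t = poly Q t"
      by (simp add: poly_square_poly m[symmetric] power_add power_mult_distrib)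
  qed
  moreover have "degree Q \<le> m"
    unfolding Q_def by (intro degree_sum_le order_trans[OF degree_monom_le]) auto
  moreover have "coeff Q j = b j" if "j \<le> m" for j
    using that by (simp add: Q_def coeff_sum)
  then have "(\<Sum>j\<le>m. coeff Q j * (pi / 2 * fact j / 2 ^ j) * Re (binom_state j p q))
    = c * (-1) ^ m * (\<Sum>j\<le>m. (-1) ^ j * fact j * esym m \<mu> (m - j) * Re (binom_state j p q))"
    unfolding sum_distrib_left
  proof (intro sum.cong refl)
    fix j assume j: "j \<in> {..m}"
    \<comment> \<open>The sign \<open>(-1) ^ (m - j)\<close> from the product expansion is split
      into the global sign and the alternating one.\<close>
    have "(-1) ^ m = (-1) ^ (m - j) * (-1 :: real) ^ j" using j by (simp flip: power_add)
    then have "(-1) ^ m * (-1) ^ j = (-1) ^ (m - j) * ((-1) ^ j * (-1) ^ j :: real)"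
      by (simp only: mult.assoc)
    also have "(-1) ^ j * (-1) ^ j = (1 :: real)" by (simp flip: power_mult_distrib)
    finally have sg: "(-1) ^ (m - j) = (-1) ^ m * (-1 :: real) ^ j" by simp
    assume "\<And>j. j \<le> m \<Longrightarrow> coeff Q j = b j"
    then show "coeff Q j * (pi / 2 * fact j / 2 ^ j) * Re (binom_state j p q)
      = c * (-1) ^ m * ((-1) ^ j * fact j * esym m \<mu> (m - j) * Re (binom_state j p q))"
      using j by (simp add: b_def sg)
  qed
  ultimately show ?thesis by (simp only: poly_op_altdef)
qed

section \<open>Equivalence of the three conditions\<close>

theorem theorem2:
  fixes n :: nat and A :: fmat
  assumes "quasi_state A"
  shows "((A \<in> extreme_points (A_oplus n))
    = (\<exists>c (k::nat) (l::nat) (lam::nat \<Rightarrow> real). c > 0 \<and> k + 2 * l \<le> n \<and> (\<forall>i<l. lam i > 0) \<and>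
         (\<forall>\<alpha>::complex. wigner A \<alpha> = complex_of_real
            (c * ((cmod \<alpha>)^2) ^ k * (\<Prod>i<l. ((cmod \<alpha>)^2 - lam i)^2) * exp (- 2 * (cmod \<alpha>)^2)))))
    \<and> ((A \<in> extreme_points (A_oplus n))
    = (\<exists>m c' (\<mu>::nat \<Rightarrow> real) (k::nat) (l::nat) (lam::nat \<Rightarrow> real).
         m \<le> n \<and> c' > 0 \<and> k + 2 * l = m \<and> (\<forall>i<l. lam i > 0) \<and>
         (\<forall>i<k. \<mu> i = 0) \<and> (\<forall>i<l. \<mu> (k + 2 * i) = lam i \<and> \<mu> (k + 2 * i + 1) = lam i) \<and>
         (\<forall>p q. A p q = complex_of_real (c' * (-1) ^ m *
             (\<Sum>j\<le>m. (-1) ^ j * fact j * esym m \<mu> (m - j) * Re (binom_state j p q))))))"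
    (is "(?i = ?ii) \<and> (?i = ?iii)")
proof -
  \<comment> \<open>\<open>sq\<close> is the polynomial form to which each of the three conditions
    is reduced.\<close>
  define sq where "sq \<longleftrightarrow> (\<exists>c k l lam. 0 < c \<and> k + 2 * l \<le> n \<and> (\<forall>i<l. 0 < lam i) \<and> A = poly_op (smult c (square_poly k l lam)))"
  have A: "hermitian_op A" "trace_class A" "op_trace A = 1"
    using assms by (auto simp: quasi_state_def)
  have i: "?i \<longleftrightarrow> sq"
  proof
    assume ext: ?i
    then have "A \<in> A_oplus n" by (simp add: extreme_points_def)
    then obtain P where P: "degree P \<le> n" "A = poly_op P" by (auto simp: A_oplus_iff)
    obtain c k l lam where "0 < c" "k + 2 * l \<le> n" "\<forall>i<l. 0 < lam i" "P = smult c (square_poly k l lam)"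
      by (rule extreme_imp_square_poly[of P n]) (use ext P in auto)
    then show sq unfolding sq_def using P(2) by blast
  next
    assume sq
    then obtain c k l lam where *: "0 < c" "k + 2 * l \<le> n" "\<forall>i<l. 0 < lam i" "A = poly_op (smult c (square_poly k l lam))"
      unfolding sq_def by blast
    \<comment> \<open>The unit trace of the given quasi-state supplies the normalisation.\<close>
    have "poly_mass (smult c (square_poly k l lam)) = 1"
      using A(3) by (simp only: *(4) op_trace_poly_op of_real_eq_1_iff)
    then show ?i unfolding *(4) by (rule square_poly_imp_extreme[OF *(1-3) refl])
  qed
  have w: "wigner (poly_op (smult c (square_poly k l lam))) \<alpha> = complex_of_real
            (c * ((cmod \<alpha>)^2) ^ k * (\<Prod>i<l. ((cmod \<alpha>)^2 - lam i)^2) * exp (- 2 * (cmod \<alpha>)^2))" for c k l lam \<alpha>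
    by (simp only: wigner_poly_op poly_smult poly_square_poly mult.assoc)
  \<comment> \<open>Injectivity holds for arbitrary quasi-states, so the finite Fock support of
    \<open>A\<close> is a consequence of the form of its Wigner function.\<close>
  have "A = poly_op (smult c (square_poly k l lam)) \<longleftrightarrow> (\<forall>\<alpha>::complex. wigner A \<alpha> = complex_of_real
            (c * ((cmod \<alpha>)^2) ^ k * (\<Prod>i<l. ((cmod \<alpha>)^2 - lam i)^2) * exp (- 2 * (cmod \<alpha>)^2)))" for c k l lam
    unfolding w[symmetric]
    using wigner_injective[OF A(1,2) poly_op_hermitian poly_op_trace_class] by metis
  then have ii: "?ii \<longleftrightarrow> sq" unfolding sq_def by simp
  have iii: "?iii \<longleftrightarrow> sq"
  proof
    assume ?iii
    then obtain m c' \<mu> k l lam where m: "m \<le> n" "0 < c'" "k + 2 * l = m" and lam: "\<forall>i<l. 0 < lam i"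
      and \<mu>: "\<forall>i<k. \<mu> i = 0" "\<forall>i<l. \<mu> (k + 2 * i) = lam i \<and> \<mu> (k + 2 * i + 1) = lam i"
      and Apq: "\<forall>p q. A p q = complex_of_real (c' * (-1) ^ m *
             (\<Sum>j\<le>m. (-1) ^ j * fact j * esym m \<mu> (m - j) * Re (binom_state j p q)))"
      by blast
    have "A = poly_op (smult (2 / pi * 2 ^ m * c') (square_poly k l (\<lambda>i. lam i / 2)))"
      by (intro ext) (simp only: poly_op_binomial_mixture[OF \<mu> m(3)] Apq)
    moreover have "0 < 2 / pi * 2 ^ m * c'" using m(2) by simp
    moreover have "\<forall>i<l. 0 < lam i / 2" using lam by simp
    moreover have "k + 2 * l \<le> n" using m by simp
    ultimately have "0 < 2 / pi * 2 ^ m * c' \<and> k + 2 * l \<le> n \<and> (\<forall>i<l. 0 < lam i / 2) \<and>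
        A = poly_op (smult (2 / pi * 2 ^ m * c') (square_poly k l (\<lambda>i. lam i / 2)))"
      by (intro conjI)
    then show sq unfolding sq_def by (intro exI)
  next
    assume sq
    then obtain c k l lam where *: "0 < c" "k + 2 * l \<le> n" "\<forall>i<l. 0 < lam i" "A = poly_op (smult c (square_poly k l lam))"
      unfolding sq_def by blast
    define m where "m = k + 2 * l"
    \<comment> \<open>The roots are doubled, \<open>div 2\<close> makes each of them occur twice in
      \<mu>, and \<open>c'\<close> solves \<open>2 / pi * 2 ^ m * c' = c\<close>.\<close>
    define lam' where "lam' i = 2 * lam i" for i
    define \<mu> where "\<mu> i = (if i < k then 0 else lam' ((i - k) div 2))" for i
    define c' where "c' = c * pi / (2 * 2 ^ m)"
    have \<mu>: "\<forall>i<k. \<mu> i = 0" "\<forall>i<l. \<mu> (k + 2 * i) = lam' i \<and> \<mu> (k + 2 * i + 1) = lam' i"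
      by (auto simp: \<mu>_def)
    have "2 / pi * 2 ^ m * c' = c" by (simp add: c'_def)
    moreover have "(\<lambda>i. lam' i / 2) = lam" by (simp add: lam'_def)
    ultimately have Apq: "A p q = complex_of_real (c' * (-1) ^ m *
             (\<Sum>j\<le>m. (-1) ^ j * fact j * esym m \<mu> (m - j) * Re (binom_state j p q)))" for p q
      using poly_op_binomial_mixture[OF \<mu> m_def[symmetric], of c' p q] *(4) by simp
    have "0 < c'" using *(1) by (simp add: c'_def)
    moreover have "\<forall>i<l. 0 < lam' i" using *(3) by (simp add: lam'_def)
    moreover have "m \<le> n" using *(2) by (simp add: m_def)
    ultimately have "m \<le> n \<and> c' > 0 \<and> k + 2 * l = m \<and> (\<forall>i<l. lam' i > 0) \<and>
         (\<forall>i<k. \<mu> i = 0) \<and> (\<forall>i<l. \<mu> (k + 2 * i) = lam' i \<and> \<mu> (k + 2 * i + 1) = lam' i) \<and>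
         (\<forall>p q. A p q = complex_of_real (c' * (-1) ^ m *
             (\<Sum>j\<le>m. (-1) ^ j * fact j * esym m \<mu> (m - j) * Re (binom_state j p q))))"
      using Apq by (intro conjI m_def[symmetric] \<mu>) simp_all
    then show ?iii by (intro exI)
  qed
  show ?thesis using i ii iii by blast
qed

end
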